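(* For each $1<p<\infty$ there exists a positive constant $c_p$, depending only on $p$, such that the following holds. Let $(\Omega,\mathcal{F},P)$ be a probability space with a filtration $(\mathcal{F}_k)_{k\ge 0}$ such that $\mathcal{F}_0=\{\emptyset,\Omega\}$, and let $(d_k)_{k\ge1}$, $(e_k)_{k\ge1}$ be real-valued martingale difference sequences with respect to $(\mathcal{F}_k)$. Suppose that for all bounded nonnegative predictable sequences $(s_k)_{k\ge1}$ and all positive integers $k$, $$E[s_k\vee |e_k|]\le E[s_k\vee |d_k|].$$ Then for all positive integers $n$, $$\left\|\sum_{k=1}^n e_k\right\|_p\le c_p\left\|\sum_{k=1}^n d_k\right\|_p .$$
   Context: A sequence $(d_k)_{k\ge1}$ is a martingale difference sequence with respect to $(\mathcal{F}_k)_{k\ge0}$ if each $d_k$ is integrable and $\mathcal{F}_k$-measurable and $E[d_k\mid\mathcal{F}_{k-1}]=0$ for all $k\ge1$. A sequence $(s_k)_{k\ge1}$ is predictable if $s_k$ is $\mathcal{F}_{k-1}$-measurable for every $k\ge1$. $a\vee b=\max(a,b)$. $\|X\|_p=(E|X|^p)^{1/p}$, which may be $+\infty$. *)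

theory Defs
  imports "HOL-Probability.Probability"
begin

text \<open>
  Sequences are indexed by all of \<^typ>\<open>nat\<close>; the entry at index 0 of the sequences \<open>d\<close>, \<open>e\<close>, \<open>s\<close>
  is never constrained and never used.
\<close>

definition martingale_difference ::
    "'a measure \<Rightarrow> (nat \<Rightarrow> 'a measure) \<Rightarrow> (nat \<Rightarrow> 'a \<Rightarrow> real) \<Rightarrow> bool" where
  "martingale_difference M F d \<longleftrightarrow>
     (\<forall>k\<ge>1. integrable M (d k) \<and> d k \<in> borel_measurable (F k) \<and>
            (AE \<omega> in M. real_cond_exp M (F (k - 1)) (d k) \<omega> = 0))"

definition predictable :: "(nat \<Rightarrow> 'a measure) \<Rightarrow> (nat \<Rightarrow> 'a \<Rightarrow> real) \<Rightarrow> bool" where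
  "predictable F s \<longleftrightarrow> (\<forall>k\<ge>1. s k \<in> borel_measurable (F (k - 1)))"

definition bounded_nonneg :: "'a measure \<Rightarrow> (nat \<Rightarrow> 'a \<Rightarrow> real) \<Rightarrow> bool" where
  "bounded_nonneg M s \<longleftrightarrow> (\<exists>B. \<forall>k\<ge>1. \<forall>\<omega>\<in>space M. 0 \<le> s k \<omega> \<and> s k \<omega> \<le> B)"

definition max_dominated ::
    "'a measure \<Rightarrow> (nat \<Rightarrow> 'a measure) \<Rightarrow> (nat \<Rightarrow> 'a \<Rightarrow> real) \<Rightarrow> (nat \<Rightarrow> 'a \<Rightarrow> real) \<Rightarrow> bool" where
  "max_dominated M F e d \<longleftrightarrow>
     (\<forall>s. predictable F s \<longrightarrow> bounded_nonneg M s \<longrightarrow>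
        (\<forall>k\<ge>1. (\<integral>\<omega>. max (s k \<omega>) \<bar>e k \<omega>\<bar> \<partial>M) \<le> (\<integral>\<omega>. max (s k \<omega>) \<bar>d k \<omega>\<bar> \<partial>M)))"

text \<open>The norm is extended-valued: it is \<open>\<infinity>\<close> when the \<open>p\<close>-th absolute moment is infinite.\<close>

definition Lp_norm :: "'a measure \<Rightarrow> real \<Rightarrow> ('a \<Rightarrow> real) \<Rightarrow> ennreal" where
  "Lp_norm M p X =
     (let I = (\<integral>\<^sup>+\<omega>. ennreal (\<bar>X \<omega>\<bar> powr p) \<partial>M)
      in if I = \<infinity> then \<infinity> else ennreal (enn2real I powr (1 / p)))"

text \<open>
  The type argument fixes the type of sample points; its value is irrelevant.
\<close>

definition moment_comparison :: "'a itself \<Rightarrow> real \<Rightarrow> real \<Rightarrow> bool" where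
  "moment_comparison T p c \<longleftrightarrow>
     (\<forall>(M :: 'a measure) F d e.
        prob_space M \<longrightarrow>
        filtration (space M) F \<longrightarrow>
        (\<forall>k. subalgebra M (F k)) \<longrightarrow>
        sets (F 0) = {{}, space M} \<longrightarrow>
        martingale_difference M F d \<longrightarrow>
        martingale_difference M F e \<longrightarrow>
        max_dominated M F e d \<longrightarrow>
        (\<forall>n\<ge>1. Lp_norm M p (\<lambda>\<omega>. \<Sum>k=1..n. e k \<omega>)
                \<le> ennreal c * Lp_norm M p (\<lambda>\<omega>. \<Sum>k=1..n. d k \<omega>)))"

text \<open>
  The constant must depend on \<open>p\<close> alone. Under an existential quantifier in a theorem that is
  polymorphic in the type of sample points, it could also depend on that type, since HOL cannot
  quantify over types inside a formula. Hence the constant is named by a closed function of \<open>p\<close>: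
  any positive constant that works for all probability spaces on one type, namely that of the
  paths \<open>k \<mapsto> (d k, e k)\<close>. A theorem about \<open>moment_comparison TYPE('a) p (comparison_const p)\<close> for
  arbitrary \<open>'a\<close> then asserts a single constant for probability spaces on all types.
  This type is no restriction: all hypotheses and the conclusion pass to the joint law of the two
  sequences, with the filtration generated by the coordinates. If there were no such constant,
  \<open>comparison_const p\<close> would be an unspecified real number.
\<close>

definition comparison_const :: "real \<Rightarrow> real" where
  "comparison_const p =
     (SOME c. 0 < c \<and> moment_comparison TYPE(nat \<Rightarrow> real \<times> real) p c)"

end

theory Submission
  imports Defs
begin

text \<open>
  Let \<open>f\<^sub>k\<close>, \<open>g\<^sub>k\<close> be the partial sums of \<open>d\<close>, \<open>e\<close>. Localizing the hypothesis to predictable sets gives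
  \<open>E w (\<bar>e\<^sub>k\<bar> - s)\<^sup>+ \<le> E w (\<bar>d\<^sub>k\<bar> - s)\<^sup>+\<close> for predictable weights \<open>w \<ge> 0\<close>; integrating over \<open>s\<close>, one may
  replace \<open>e\<^sub>k\<close> by \<open>d\<^sub>k\<close> in any \<open>E \<phi>(\<bar>e\<^sub>k\<bar>)\<close> with \<open>\<phi>\<close> convex, increasing and with predictable coefficients.
  Write \<open>\<psi>(R, t) = max(R, t)\<^sup>p\<^sup>-\<^sup>2 t\<^sup>2\<close>, which is equivalent to such a \<open>\<phi>\<close>.

  For \<open>p \<le> 2\<close>, second-order expansion of \<open>\<bar>\<cdot>\<bar>\<^sup>p\<close> bounds the increments of \<open>E \<bar>f\<^sub>k\<bar>\<^sup>p\<close> below by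
  \<open>c E \<psi>(\<bar>f\<^sub>k\<^sub>-\<^sub>1\<bar>, \<bar>d\<^sub>k\<bar>)\<close> and those of \<open>E \<bar>(f\<^sub>k, g\<^sub>k)\<bar>\<^sup>p\<close> above by
  \<open>C E (\<psi>(R, \<bar>d\<^sub>k\<bar>) + \<psi>(R, \<bar>e\<^sub>k\<bar>))\<close> with \<open>R = \<bar>(f\<^sub>k\<^sub>-\<^sub>1, g\<^sub>k\<^sub>-\<^sub>1)\<bar>\<close>. After replacing \<open>e\<^sub>k\<close> by \<open>d\<^sub>k\<close>, the latter is
  controlled by the former, because \<open>\<psi>\<close> decreases in \<open>R\<close>.

  For \<open>p > 2\<close>, the increments of \<open>E \<bar>g\<^sub>k\<bar>\<^sup>p\<close> are at most
  \<open>C E (\<bar>g\<^sub>k\<^sub>-\<^sub>1\<bar>\<^sup>p\<^sup>-\<^sup>2 d\<^sub>k\<^sup>2 + \<bar>d\<^sub>k\<bar>\<^sup>p)\<close>. The terms \<open>E \<bar>d\<^sub>k\<bar>\<^sup>p\<close> sum up to \<open>C E \<bar>f\<^sub>n\<bar>\<^sup>p\<close>. With the running maximum \<open>G\<^sub>k\<close>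
  of \<open>\<bar>g\<bar>\<close>, the other terms are dominated by the increments of \<open>E G\<^sub>k\<^sup>p\<^sup>-\<^sup>2 f\<^sub>k\<^sup>2\<close>, and
  \<open>G\<^sub>n\<^sup>p\<^sup>-\<^sup>2 f\<^sub>n\<^sup>2 \<le> \<epsilon> G\<^sub>n\<^sup>p + C\<^sub>\<epsilon> \<bar>f\<^sub>n\<bar>\<^sup>p\<close> is absorbed by Doob's maximal inequality.
\<close>

subsection \<open>Inequalities for powers\<close>

text \<open>The odd extension of \<open>x powr r\<close>; for \<open>r = p - 1\<close> it is, up to
  the factor \<open>p\<close>, the derivative of \<open>|x| powr p\<close>.\<close>

definition signed_powr :: "real \<Rightarrow> real \<Rightarrow> real" where
  "signed_powr r x = sgn x * \<bar>x\<bar> powr r"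

lemma signed_powr_0 [simp]: "signed_powr r 0 = 0"
  by (simp add: signed_powr_def)

lemma signed_powr_minus: "signed_powr r (- x) = - signed_powr r x"
  by (simp add: signed_powr_def sgn_if)

lemma signed_powr_nonneg: "0 \<le> x \<Longrightarrow> signed_powr r x = x powr r"
  by (auto simp: signed_powr_def sgn_if)

lemma abs_signed_powr: "\<bar>signed_powr r x\<bar> = \<bar>x\<bar> powr r"
  by (auto simp: signed_powr_def abs_mult sgn_if)

lemma signed_powr_measurable [measurable]: "signed_powr r \<in> borel_measurable borel"
  unfolding signed_powr_def by measurable

lemma has_real_derivative_abs_powr:
  fixes x :: real
  assumes p: "1 < p"
  shows "((\<lambda>y. \<bar>y\<bar> powr p) has_real_derivative p * signed_powr (p - 1) x) (at x)"
proof -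
  consider "x > 0" | "x < 0" | "x = 0" by linarith
  then show ?thesis
  proof cases
    case 1
    have "((\<lambda>y. y powr p) has_real_derivative p * x powr (p - 1)) (at x)"
      using 1 by (rule has_real_derivative_powr)
    then have "((\<lambda>y. y powr p) has_real_derivative p * signed_powr (p - 1) x) (at x)"
      using 1 by (simp add: signed_powr_nonneg)
    then show ?thesis
      by (rule has_field_derivative_transform_within_open[of _ _ _ "{0<..}"]) (use 1 in auto)
  next
    case 2
    have "((\<lambda>y. (- y) powr p) has_real_derivative (p * (- x) powr (p - 1)) * (-1)) (at x)"
      by (rule DERIV_chain2[OF has_real_derivative_powr]) (use 2 in \<open>auto intro!: derivative_eq_intros\<close>)
    then have "((\<lambda>y. (- y) powr p) has_real_derivative p * signed_powr (p - 1) x) (at x)"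
      using 2 by (simp add: signed_powr_def)
    then show ?thesis
      by (rule has_field_derivative_transform_within_open[of _ _ _ "{..<0}"]) (use 2 in auto)
  next
    case 3
    \<comment> \<open>At 0 the difference quotient is \<open>|h| powr p / h\<close>, of size at most
      \<open>|h| powr (p - 1)\<close>, which tends to 0 because \<open>1 < p\<close>.\<close>
    have lim: "((\<lambda>h::real. \<bar>h\<bar> powr (p - 1)) \<longlongrightarrow> 0) (at 0)"
      by (rule tendsto_eq_intros refl)+ (use p in auto)
    have "\<forall>h::real. norm (\<bar>h\<bar> powr p / h) \<le> \<bar>h\<bar> powr (p - 1)"
      by (auto simp: powr_diff)
    then have "((\<lambda>h::real. \<bar>h\<bar> powr p / h) \<longlongrightarrow> 0) (at 0)"
      by (rule Lim_null_comparison[OF always_eventually lim])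
    then show ?thesis using 3 p by (simp add: DERIV_def)
  qed
qed

text \<open>Subtracting the linear function of slope \<open>q * M powr (q - 1)\<close> from
  \<open>y powr q\<close> leaves a monotone function on \<open>[a, b]\<close>: for
  \<open>0 < y \<le> M\<close> the derivative \<open>q * y powr (q - 1)\<close> lies on one side of
  that slope, depending on the sign of \<open>q - 1\<close>.\<close>

lemma powr_diff_bounds:
  fixes a b M q :: real
  assumes q: "0 < q" and ab: "0 \<le> a" "a \<le> b" "b \<le> M"
  shows "q \<le> 1 \<Longrightarrow> q * M powr (q - 1) * (b - a) \<le> b powr q - a powr q"
    and "1 \<le> q \<Longrightarrow> b powr q - a powr q \<le> q * M powr (q - 1) * (b - a)"
proof -
  let ?c = "q * M powr (q - 1)"
  have der: "((\<lambda>y. y powr q - ?c * y) has_real_derivative q * x powr (q - 1) - ?c) (at x)" if "0 < x" for x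
    using that by (auto intro!: derivative_eq_intros)
  have con: "continuous_on {a..b} (\<lambda>y. y powr q - ?c * y)"
    using q ab by (intro continuous_intros continuous_on_powr') auto
  show "?c * (b - a) \<le> b powr q - a powr q" if "q \<le> 1"
  proof -
    have "a powr q - ?c * a \<le> b powr q - ?c * b"
    proof (rule DERIV_nonneg_imp_increasing_open[OF ab(2) _ con])
      fix x assume x: "a < x" "x < b"
      have "M powr (q - 1) \<le> x powr (q - 1)" using x ab that by (intro powr_mono2') auto
      then have "0 \<le> q * x powr (q - 1) - ?c" using q by simp
      with der[of x] x ab show "\<exists>y. ((\<lambda>y. y powr q - ?c * y) has_real_derivative y) (at x) \<and> 0 \<le> y"
        by auto
    qed
    then show ?thesis by (simp add: algebra_simps)
  qed
  show "b powr q - a powr q \<le> ?c * (b - a)" if "1 \<le> q"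
  proof -
    have "- (a powr q - ?c * a) \<le> - (b powr q - ?c * b)"
    proof (rule DERIV_nonneg_imp_increasing_open[OF ab(2) _ continuous_on_minus[OF con]])
      fix x assume x: "a < x" "x < b"
      have "x powr (q - 1) \<le> M powr (q - 1)" using x ab that by (intro powr_mono2) auto
      then have "0 \<le> - (q * x powr (q - 1) - ?c)" using q by simp
      with DERIV_minus[OF der[of x]] x ab
      show "\<exists>y. ((\<lambda>y. - (y powr q - ?c * y)) has_real_derivative y) (at x) \<and> 0 \<le> y"
        by auto
    qed
    then show ?thesis by (simp add: algebra_simps)
  qed
qed

text \<open>By oddness an interval on one side of 0 reduces to ordinary powers; an interval
  containing 0 is split there and the two estimates are added.\<close>

lemma signed_powr_diff_bounds:
  fixes a b M q :: real
  assumes q: "0 < q" and ab: "- M \<le> a" "a \<le> b" "b \<le> M"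
  shows "q \<le> 1 \<Longrightarrow> q * M powr (q - 1) * (b - a) \<le> signed_powr q b - signed_powr q a"
    and "1 \<le> q \<Longrightarrow> signed_powr q b - signed_powr q a \<le> q * M powr (q - 1) * (b - a)"
proof -
  have neg: "signed_powr q x = - ((- x) powr q)" if "x \<le> 0" for x
    using that signed_powr_minus[of q "-x"] signed_powr_nonneg[of "-x" q] by simp
  note pos = signed_powr_nonneg
  consider "0 \<le> a" | "b \<le> 0" | "a \<le> 0" "0 \<le> b" by linarith
  note cases = this
  show "q * M powr (q - 1) * (b - a) \<le> signed_powr q b - signed_powr q a" if "q \<le> 1"
    using cases
  proof cases
    case 1 then show ?thesis using powr_diff_bounds(1)[OF q, of a b M] ab that by (simp add: pos)
  next
    case 2 then show ?thesis using powr_diff_bounds(1)[OF q, of "-b" "-a" M] ab that by (simp add: neg)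
  next
    case 3 then show ?thesis
      using powr_diff_bounds(1)[OF q, of 0 b M] powr_diff_bounds(1)[OF q, of 0 "-a" M] ab that
      by (simp add: neg pos algebra_simps)
  qed
  show "signed_powr q b - signed_powr q a \<le> q * M powr (q - 1) * (b - a)" if "1 \<le> q"
    using cases
  proof cases
    case 1 then show ?thesis using powr_diff_bounds(2)[OF q, of a b M] ab that by (simp add: pos)
  next
    case 2 then show ?thesis using powr_diff_bounds(2)[OF q, of "-b" "-a" M] ab that by (simp add: neg)
  next
    case 3 then show ?thesis
      using powr_diff_bounds(2)[OF q, of 0 b M] powr_diff_bounds(2)[OF q, of 0 "-a" M] ab that
      by (simp add: neg pos algebra_simps)
  qed
qed

text \<open>On the interval of radius \<open>M = |x| + |h|\<close> the second derivative of
  \<open>|y| powr p\<close> is at least (\<open>p \<le> 2\<close>) or at most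
  (\<open>2 \<le> p\<close>) its value at the endpoints. Subtracting the quadratic with that second
  derivative leaves a convex or concave function \<open>f\<close>, and the claim is its tangent
  inequality at \<open>x\<close>. Monotonicity of \<open>f'\<close> is used instead of second
  derivatives, which may fail to exist at 0.\<close>

lemma abs_powr_second_order:
  fixes p x h :: real
  assumes p: "1 < p"
  defines "Q \<equiv> p * (p - 1) / 2 * (\<bar>x\<bar> + \<bar>h\<bar>) powr (p - 2) * h\<^sup>2"
  shows "p \<le> 2 \<Longrightarrow> \<bar>x\<bar> powr p + p * signed_powr (p - 1) x * h + Q \<le> \<bar>x + h\<bar> powr p"
    and "2 \<le> p \<Longrightarrow> \<bar>x + h\<bar> powr p \<le> \<bar>x\<bar> powr p + p * signed_powr (p - 1) x * h + Q"
proof -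
  define M where "M = \<bar>x\<bar> + \<bar>h\<bar>"
  define c where "c = (p - 1) * M powr (p - 2)"
  define f where "f = (\<lambda>y. \<bar>y\<bar> powr p - p * c / 2 * y\<^sup>2)"
  define f' where "f' = (\<lambda>y. p * (signed_powr (p - 1) y - c * y))"
  have der: "(f has_real_derivative f' y) (at y)" for y
  proof -
    have "((\<lambda>y. p * c / 2 * y\<^sup>2) has_real_derivative p * (c * y)) (at y)"
      by (auto intro!: derivative_eq_intros)
    from DERIV_diff[OF has_real_derivative_abs_powr[OF p] this] show ?thesis
      by (simp add: f_def f'_def right_diff_distrib)
  qed
  have Q: "f (x + h) - f x - f' x * h = \<bar>x + h\<bar> powr p - \<bar>x\<bar> powr p - p * signed_powr (p - 1) x * h - Q"
    unfolding f_def f'_def Q_def c_def M_def by (simp add: field_simps power2_eq_square)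
  \<comment> \<open>For \<open>h \<noteq> 0\<close> the point of tangency \<open>x\<close> is
    interior to \<open>[-M, M]\<close>; the point \<open>x + h\<close> may be an endpoint.\<close>
  have mem: "x \<in> interior {- M..M}" "x + h \<in> {- M..M}" if "h \<noteq> 0"
    using that by (auto simp: M_def interior_atLeastAtMost_real)
  have d0: "f (x + h) - f x - f' x * h = 0" if "h = 0" using that by simp
  have m1: "f' a \<le> f' b" if "p \<le> 2" "a \<in> {- M..M}" "b \<in> {- M..M}" "a \<le> b" for a b
    using signed_powr_diff_bounds(1)[of "p - 1" M a b] that p
    unfolding f'_def by (intro mult_left_mono) (auto simp: c_def algebra_simps)
  have m2: "- f' a \<le> - f' b" if "2 \<le> p" "a \<in> {- M..M}" "b \<in> {- M..M}" "a \<le> b" for a b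
  proof -
    have "f' b \<le> f' a"
      using signed_powr_diff_bounds(2)[of "p - 1" M a b] that p
      unfolding f'_def by (intro mult_left_mono) (auto simp: c_def algebra_simps)
    then show ?thesis by simp
  qed
  show "\<bar>x\<bar> powr p + p * signed_powr (p - 1) x * h + Q \<le> \<bar>x + h\<bar> powr p" if "p \<le> 2"
  proof (cases "h = 0")
    case False
    have "convex_on {- M..M} f"
      by (rule convex_on_realI[OF _ der m1]) (use that in auto)
    from convex_on_imp_above_tangent[OF this _ mem[OF False], of "f' x"] der[of x] Q show ?thesis
      by (auto simp: has_field_derivative_at_within)
  qed (simp add: Q_def)
  show "\<bar>x + h\<bar> powr p \<le> \<bar>x\<bar> powr p + p * signed_powr (p - 1) x * h + Q" if "2 \<le> p"
  proof (cases "h = 0")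
    case False
    have "convex_on {- M..M} (\<lambda>y. - f y)"
      by (rule convex_on_realI[OF _ DERIV_minus[OF der] m2]) (use that in auto)
    from convex_on_imp_above_tangent[OF this _ mem[OF False], of "- f' x"] DERIV_minus[OF der[of x]] Q show ?thesis
      by (auto simp: has_field_derivative_at_within)
  qed (simp add: Q_def)
qed

lemma convex_on_abs_powr:
  assumes "1 < p"
  shows "convex_on UNIV (\<lambda>x::real. \<bar>x\<bar> powr p)"
proof (rule convex_on_realI[OF _ has_real_derivative_abs_powr[OF assms]])
  fix a b :: real assume ab: "a \<le> b"
  consider "0 \<le> a" | "b \<le> 0" | "a \<le> 0" "0 \<le> b" by linarith
  then have "signed_powr (p - 1) a \<le> signed_powr (p - 1) b"
  proof cases
    case 1 then show ?thesis using assms ab by (simp add: signed_powr_nonneg powr_mono2)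
  next
    case 2
    have "signed_powr (p - 1) (- b) \<le> signed_powr (p - 1) (- a)"
      using assms ab 2 by (simp add: signed_powr_nonneg powr_mono2)
    then show ?thesis by (simp add: signed_powr_minus)
  next
    case 3
    have "0 \<le> signed_powr (p - 1) (- a)" "0 \<le> signed_powr (p - 1) b"
      using 3 by (simp_all add: signed_powr_nonneg)
    then show ?thesis by (simp add: signed_powr_minus)
  qed
  then show "p * signed_powr (p - 1) a \<le> p * signed_powr (p - 1) b"
    using assms by simp
qed auto

lemma abs_powr_tangent:
  fixes x h :: real
  assumes p: "1 < p"
  shows "\<bar>x\<bar> powr p + p * signed_powr (p - 1) x * h \<le> \<bar>x + h\<bar> powr p"
  using convex_on_imp_above_tangent[OF convex_on_abs_powr[OF p], of x "x + h" "p * signed_powr (p - 1) x"]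
    has_real_derivative_abs_powr[OF p, of x] by simp

text \<open>Write \<open>a powr r = a * a powr (r - 1)\<close> and enlarge the second factor to
  \<open>(a + b) powr (r - 1)\<close>.\<close>

lemma powr_superadditive:
  fixes a b r :: real
  assumes "0 \<le> a" "0 \<le> b" "1 \<le> r"
  shows "a powr r + b powr r \<le> (a + b) powr r"
proof -
  have *: "x powr r = x * x powr (r - 1)" if "0 \<le> x" for x :: real
    using that by (cases "x = 0") (auto simp: powr_diff)
  have "a * a powr (r - 1) + b * b powr (r - 1) \<le> a * (a + b) powr (r - 1) + b * (a + b) powr (r - 1)"
    using assms by (intro add_mono mult_left_mono powr_mono2) auto
  then show ?thesis using assms by (simp add: * algebra_simps)
qed

lemma power2_powr_half: "(x\<^sup>2) powr (p / 2) = \<bar>x\<bar> powr p" for x :: real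
proof (cases "x = 0")
  case False
  then have "x\<^sup>2 = \<bar>x\<bar> powr 2" by simp
  then show ?thesis by (simp only: powr_powr) simp
qed simp

lemma abs_powr_2: "\<bar>y\<bar> powr 2 = y\<^sup>2" for y :: real
  by (cases "y = 0") auto

text \<open>Superadditivity with exponent \<open>p / 2\<close> gives the upper bound
  \<open>(u^2 + v^2) powr (p / 2)\<close>. Since \<open>u^2 + v^2\<close> is the mean of
  \<open>(u + v)^2\<close> and \<open>(u - v)^2\<close>, convexity of the same power
  finishes.\<close>

lemma clarkson_inequality:
  fixes u v p :: real
  assumes p: "2 \<le> p"
  shows "2 * (\<bar>u\<bar> powr p + \<bar>v\<bar> powr p) \<le> \<bar>u + v\<bar> powr p + \<bar>u - v\<bar> powr p"
proof -
  define r where "r = p / 2"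
  have r: "1 \<le> r" using p by (simp add: r_def)
  have sq: "(x\<^sup>2) powr r = \<bar>x\<bar> powr p" for x :: real
    by (simp add: r_def power2_powr_half)
  have cv: "convex_on {0..} (\<lambda>x::real. x powr r)" 
  proof (rule convex_onI)
    fix t x y :: real
    assume t: "0 < t" "t < 1" and xy: "x \<in> {0..}" "y \<in> {0..}"
    \<comment> \<open>When one of the two points is 0, convexity reduces to these bounds on the
      weights.\<close>
    have sub: "t powr r \<le> t" "(1 - t) powr r \<le> 1 - t" using t r powr_mono'[of 1 r t]  powr_mono'[of 1 r "1 - t"] by auto
    consider "x = 0" | "y = 0" | "x > 0" "y > 0" using xy by force
    then show "((1 - t) *\<^sub>R x + t *\<^sub>R y) powr r \<le> (1 - t) * x powr r + t * y powr r"
    proof cases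
      case 3 then show ?thesis using convex_onD[OF powr_convex[OF r], of t x y] t by auto
    qed (use t xy sub in \<open>auto simp: powr_mult intro!: mult_right_mono\<close>)
  qed auto
  have "\<bar>u\<bar> powr p + \<bar>v\<bar> powr p \<le> (u\<^sup>2 + v\<^sup>2) powr r"
    using powr_superadditive[of "u\<^sup>2" "v\<^sup>2" r] r by (simp add: sq)
  also have "\<dots> = ((1 - 1/2) *\<^sub>R (u + v)\<^sup>2 + (1/2) *\<^sub>R (u - v)\<^sup>2) powr r"
    by (rule arg_cong[of _ _ "\<lambda>x. x powr r"]) (simp add: power2_eq_square algebra_simps)
  also have "\<dots> \<le> (1 - 1/2) * ((u + v)\<^sup>2) powr r + 1/2 * ((u - v)\<^sup>2) powr r"
    by (rule convex_onD[OF cv]) auto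
  finally show ?thesis by (simp add: sq)
qed

text \<open>The tangent at \<open>x\<close> bounds the value at the midpoint
  \<open>x + h / 2\<close> from below, and Clarkson's inequality for the midpoint and
  \<open>h / 2\<close> compares it with the values at the ends, leaving the gain
  \<open>2 * |h / 2| powr p\<close>.\<close>

lemma abs_powr_uniformly_convex:
  fixes x h p :: real
  assumes p: "2 \<le> p"
  shows "\<bar>x\<bar> powr p + p * signed_powr (p - 1) x * h + 2 powr (1 - p) * \<bar>h\<bar> powr p \<le> \<bar>x + h\<bar> powr p"
proof -
  have "\<bar>x\<bar> powr p + p * signed_powr (p - 1) x * (h / 2) \<le> \<bar>x + h / 2\<bar> powr p"
    using p by (intro abs_powr_tangent) auto
  moreover have "2 * (\<bar>x + h / 2\<bar> powr p + \<bar>h / 2\<bar> powr p) \<le> \<bar>x + h\<bar> powr p + \<bar>x\<bar> powr p"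
    using clarkson_inequality[OF p, of "x + h / 2" "h / 2"] by (simp add: add.commute)
  moreover have "2 * \<bar>h / 2\<bar> powr p = 2 powr (1 - p) * \<bar>h\<bar> powr p"
    by (simp add: powr_divide powr_diff)
  ultimately show ?thesis by (simp add: algebra_simps)
qed

text \<open>Weighted arithmetic-geometric mean inequality for \<open>t\<close> and \<open>s\<close>,
  divided by \<open>s powr (1 - r)\<close>.\<close>

lemma powr_concave_tangent:
  fixes t s r :: real
  assumes "0 \<le> t" "0 < s" "0 < r" "r \<le> 1"
  shows "t powr r \<le> s powr r + r * s powr (r - 1) * (t - s)"
proof (cases "t = 0")
  case True
  have "r * s powr (r - 1) * s \<le> 1 * s powr r" using assms by (simp add: powr_diff)
  then show ?thesis using True by simp
next
  case False
  have "t powr r * s powr (1 - r) \<le> r * t + (1 - r) * s"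
    using assms False by (intro Youngs_inequality_0) auto
  then have "(t powr r * s powr (1 - r)) * s powr (r - 1) \<le> (r * t + (1 - r) * s) * s powr (r - 1)"
    by (rule mult_right_mono) simp
  moreover have "s powr (1 - r) * s powr (r - 1) = 1" using assms by (simp flip: powr_add)
  moreover have "s powr r = s * s powr (r - 1)" using assms by (simp add: powr_diff)
  ultimately show ?thesis by (simp add: algebra_simps)
qed

text \<open>For \<open>norm h \<le> norm x\<close>, the tangent of the concave function
  \<open>t powr (p / 2)\<close> at \<open>(norm x)^2\<close> applies to the exact expansion of
  \<open>(norm (x + h))^2\<close>. For larger \<open>h\<close> every term is of order
  \<open>norm h powr p\<close> or has the right sign.\<close>

lemma norm_powr_second_order:
  fixes x h :: "'a :: real_inner"
  assumes p: "1 < p" "p \<le> 2"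
  shows "norm (x + h) powr p \<le> norm x powr p + p * norm x powr (p - 2) * inner x h
           + 6 * (max (norm x) (norm h) powr (p - 2) * (norm h)\<^sup>2)"
proof (cases "norm h \<le> norm x")
  case True
  show ?thesis
  proof (cases "x = 0")
    case False
    let ?n = "norm x"
    have n: "?n > 0" using False by simp
    have "norm (x + h) powr p = ((norm (x + h))\<^sup>2) powr (p / 2)" by (simp add: power2_powr_half)
    also have "\<dots> \<le> (?n\<^sup>2) powr (p / 2) + p / 2 * (?n\<^sup>2) powr (p / 2 - 1) * ((norm (x + h))\<^sup>2 - ?n\<^sup>2)"
      using p n by (intro powr_concave_tangent) auto
    also have "(?n\<^sup>2) powr (p / 2 - 1) = ?n powr (p - 2)"
      using power2_powr_half[of ?n "p - 2"] by (simp add: diff_divide_distrib)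
    also have "(?n\<^sup>2) powr (p / 2) = ?n powr p" by (simp add: power2_powr_half)
    also have "(norm (x + h))\<^sup>2 - ?n\<^sup>2 = 2 * inner x h + (norm h)\<^sup>2"
      by (simp add: power2_norm_eq_inner inner_add_left inner_add_right inner_commute)
    also have "p / 2 * ?n powr (p - 2) * (2 * inner x h + (norm h)\<^sup>2)
        = p * ?n powr (p - 2) * inner x h + p / 2 * (?n powr (p - 2) * (norm h)\<^sup>2)"
      by (simp add: algebra_simps)
    also have "p / 2 * (?n powr (p - 2) * (norm h)\<^sup>2) \<le> 6 * (?n powr (p - 2) * (norm h)\<^sup>2)"
      using p by (intro mult_right_mono) auto
    finally show ?thesis using True by (simp add: max_def split: if_splits)
  qed (use True in simp)
next
  case False
  then have h: "0 < norm h" using norm_ge_zero[of x] by linarith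
  have e: "norm h powr (p - 2) * (norm h)\<^sup>2 = norm h powr p"
    using h by (simp add: powr_diff)
  have "norm (x + h) powr p \<le> (2 * norm h) powr p"
    using False p norm_triangle_ineq[of x h] by (intro powr_mono2) auto
  also have "\<dots> \<le> 4 * norm h powr p"
    using p powr_mono[of p 2 "2::real"] by (auto simp: powr_mult intro!: mult_right_mono)
  finally have 1: "norm (x + h) powr p \<le> 4 * norm h powr p" .
  \<comment> \<open>The linear term may be negative, but its size is at most
    \<open>2 * norm h powr p\<close>; with the factor 4 above this produces the constant 6.\<close>
  have "norm x powr (p - 2) * - inner x h \<le> norm x powr (p - 2) * (norm x * norm h)"
    using Cauchy_Schwarz_ineq2[of x h] by (intro mult_left_mono) auto
  also have "\<dots> = norm x powr (p - 1) * norm h"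
    by (cases "x = 0") (auto simp: powr_diff power2_eq_square)
  also have "\<dots> \<le> norm h powr (p - 1) * norm h"
    using False p by (intro mult_right_mono powr_mono2) auto
  also have "\<dots> = norm h powr p" using h by (simp add: powr_diff)
  finally have "p * (norm x powr (p - 2) * - inner x h) \<le> p * norm h powr p"
    using p by (intro mult_left_mono) auto
  also have "\<dots> \<le> 2 * norm h powr p" using p by (intro mult_right_mono) auto
  finally have "- (p * norm x powr (p - 2) * inner x h) \<le> 2 * norm h powr p" by simp
  with 1 False show ?thesis by (simp add: max_def e) (smt (verit) powr_ge_zero)
qed

text \<open>A form of Young's inequality without sharp constants: with
  \<open>\<delta> powr s = \<epsilon>\<close>, either \<open>b \<le> \<delta> * a\<close> or
  \<open>a \<le> b / \<delta>\<close>, and the smaller quantity is replaced by the larger. It serves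
  to absorb terms into a left-hand side.\<close>

lemma powr_mult_powr_le:
  fixes a b r s \<epsilon> :: real
  assumes "0 < r" "0 < s" "0 < \<epsilon>" "0 \<le> a" "0 \<le> b"
  shows "a powr r * b powr s \<le> \<epsilon> * a powr (r + s) + \<epsilon> powr (- (r / s)) * b powr (r + s)"
proof -
  define \<delta> where "\<delta> = \<epsilon> powr (1 / s)"
  have \<delta>: "0 < \<delta>" "\<delta> powr s = \<epsilon>" "\<epsilon> powr (- (r / s)) = (1 / \<delta>) powr r"
    using assms by (auto simp: \<delta>_def powr_powr powr_divide powr_minus_divide)
  show ?thesis
  proof (cases "b \<le> \<delta> * a")
    case True
    have "a powr r * b powr s \<le> a powr r * (\<delta> * a) powr s"
      using True assms by (intro mult_left_mono powr_mono2) auto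
    also have "\<dots> = \<epsilon> * a powr (r + s)" using \<delta> assms by (simp add: powr_mult powr_add)
    finally show ?thesis by (smt (verit) mult_nonneg_nonneg powr_ge_zero)
  next
    case False
    then have "a \<le> 1 / \<delta> * b" using \<delta> by (simp add: field_simps)
    then have "a powr r * b powr s \<le> (1 / \<delta> * b) powr r * b powr s"
      using assms by (intro mult_right_mono powr_mono2) auto
    also have "\<dots> = (1 / \<delta>) powr r * b powr (r + s)"
      using \<delta> assms powr_mult[of "1/\<delta>" b r] by (simp add: powr_add)
    finally show ?thesis unfolding \<delta>(3) using assms by (smt (verit) mult_nonneg_nonneg powr_ge_zero)
  qed
qed

lemma powr_mult_powr_le_add:
  fixes a b r s :: real
  assumes "0 \<le> r" "0 \<le> s" "0 \<le> a" "0 \<le> b"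
  shows "a powr r * b powr s \<le> a powr (r + s) + b powr (r + s)"
proof -
  have "a powr r * b powr s \<le> max a b powr r * max a b powr s"
    using assms by (intro mult_mono powr_mono2) auto
  also have "\<dots> = max a b powr (r + s)" by (simp add: powr_add)
  also have "\<dots> \<le> a powr (r + s) + b powr (r + s)" by (simp add: max_def)
  finally show ?thesis .
qed

lemma add_powr_le:
  fixes a b r :: real
  assumes "0 \<le> r" "0 \<le> a" "0 \<le> b"
  shows "(a + b) powr r \<le> 2 powr r * (a powr r + b powr r)"
proof -
  have "(a + b) powr r \<le> (2 * max a b) powr r"
    using assms by (intro powr_mono2) auto
  also have "\<dots> = 2 powr r * max a b powr r" using assms by (simp add: powr_mult)
  also have "\<dots> \<le> 2 powr r * (a powr r + b powr r)" by (intro mult_left_mono) (auto simp: max_def)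
  finally show ?thesis .
qed

text \<open>The sum is at most twice the maximum and the exponent \<open>p - 2\<close> is
  nonpositive. This brings the second-order remainder into the form used for the comparison.\<close>

lemma double_max_powr_le:
  fixes x h p :: real
  assumes "1 < p" "p \<le> 2"
  shows "2 powr (p - 2) * (max \<bar>x\<bar> \<bar>h\<bar> powr (p - 2) * h\<^sup>2) \<le> (\<bar>x\<bar> + \<bar>h\<bar>) powr (p - 2) * h\<^sup>2"
proof (cases "h = 0")
  case False
  have "2 powr (p - 2) * max \<bar>x\<bar> \<bar>h\<bar> powr (p - 2) = (2 * max \<bar>x\<bar> \<bar>h\<bar>) powr (p - 2)"
    by (simp add: powr_mult)
  also have "\<dots> \<le> (\<bar>x\<bar> + \<bar>h\<bar>) powr (p - 2)"
    using assms False by (intro powr_mono2') auto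
  finally show ?thesis by (simp only: mult.assoc[symmetric]) (rule mult_right_mono, auto)
qed simp

subsection \<open>Consequences of hinge domination\<close>

text \<open>Up to a factor, \<open>x powr q\<close> is a mixture of the hinges
  \<open>max 0 (x - s)\<close> with density \<open>s powr (q - 2)\<close>, so a domination of hinges
  integrates to one of powers. The embedding \<open>ennreal (x - s)\<close> vanishes for
  \<open>s > x\<close> and thus is the hinge.\<close>

lemma nn_integral_hinge_powr:
  fixes x q :: real
  assumes x: "0 \<le> x" and q: "1 < q"
  shows "(\<integral>\<^sup>+s. ennreal (x - s) * (ennreal (s powr (q - 2)) * indicator {0<..} s) \<partial>lborel)
          = ennreal (x powr q / (q * (q - 1)))"
proof -
  have "((\<lambda>s. x * s powr (q - 2) - s powr (q - 1)) has_integral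
          x * (x powr (q - 2 + 1) / (q - 2 + 1)) - x powr (q - 1 + 1) / (q - 1 + 1)) {0..x}"
    using x q by (intro has_integral_diff has_integral_mult_right has_integral_powr_from_0) auto
  moreover have "x * (x powr (q - 2 + 1) / (q - 2 + 1)) - x powr (q - 1 + 1) / (q - 1 + 1)
      = x powr q / (q * (q - 1))"
    using x q by (cases "x = 0") (auto simp: powr_diff divide_simps algebra_simps)
  moreover have "x * s powr (q - 2) - s powr (q - 1) = (x - s) * s powr (q - 2)" if "s \<in> {0..x}" for s
    using that by (cases "s = 0") (auto simp: powr_diff divide_simps power2_eq_square algebra_simps)
  ultimately have I: "((\<lambda>s. (x - s) * s powr (q - 2)) has_integral x powr q / (q * (q - 1))) {0..x}"
    by (metis (no_types, lifting) has_integral_cong)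
  have "(\<integral>\<^sup>+s. ennreal (x - s) * (ennreal (s powr (q - 2)) * indicator {0<..} s) \<partial>lborel)
      = (\<integral>\<^sup>+s. ennreal ((x - s) * s powr (q - 2)) * indicator {0..x} s \<partial>lborel)"
    by (intro nn_integral_cong) (auto simp: indicator_def ennreal_mult ennreal_neg)
  also have "\<dots> = ennreal (x powr q / (q * (q - 1)))"
    by (rule nn_integral_has_integral_lebesgue'[OF _ I]) auto
  finally show ?thesis .
qed

text \<open>The function \<psi> of the overview. It is quadratic,
  \<open>R powr (p - 2) * t^2\<close>, for \<open>0 \<le> t \<le> R\<close> and equals
  \<open>t powr p\<close> for \<open>t \<ge> R \<ge> 0\<close>.\<close>

definition truncated_powr :: "real \<Rightarrow> real \<Rightarrow> real \<Rightarrow> real" where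
  "truncated_powr p R t = max R t powr (p - 2) * t\<^sup>2"

lemma truncated_powr_nonneg: "0 \<le> truncated_powr p R t"
  by (simp add: truncated_powr_def)

lemma truncated_powr_measurable [measurable]:
  assumes [measurable]: "R \<in> borel_measurable M" "X \<in> borel_measurable M"
  shows "(\<lambda>\<omega>. truncated_powr p (R \<omega>) (X \<omega>)) \<in> borel_measurable M"
  unfolding truncated_powr_def by measurable

lemma truncated_powr_antimono:
  assumes "p \<le> 2" "R \<le> R'" "0 \<le> R" "0 \<le> t"
  shows "truncated_powr p R' t \<le> truncated_powr p R t"
proof (cases "t = 0")
  case False
  then show ?thesis unfolding truncated_powr_def
    using assms by (intro mult_right_mono powr_mono2') auto
qed (simp add: truncated_powr_def)

lemma powr_minus_2_mult: "0 \<le> t \<Longrightarrow> t powr (p - 2) * t\<^sup>2 = t powr p" for t :: real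
  by (cases "t = 0") (auto simp: powr_diff)

lemma truncated_powr_le:
  assumes "p \<le> 2" "0 \<le> R" "0 \<le> t"
  shows "truncated_powr p R t \<le> t powr p"
  using truncated_powr_antimono[of p 0 R t] assms
  by (simp add: truncated_powr_def powr_minus_2_mult max_def)

text \<open>\<open>truncated_powr\<close> is compared here with the mixture of hinges of density
  \<open>max R s powr (p - 2)\<close>. From below, the density on \<open>s < x\<close> is at least
  its value at \<open>x\<close>. From above, it is at most \<open>R powr (p - 2)\<close> if
  \<open>x < R\<close>, and at most \<open>s powr (p - 2)\<close> otherwise.\<close>

lemma truncated_powr_hinge_bounds:
  fixes x R p :: real
  assumes p: "1 < p" "p \<le> 2" and x: "0 \<le> x" and R: "0 \<le> R"
  defines "I \<equiv> \<integral>\<^sup>+s. ennreal (x - s) * (ennreal (max R s powr (p - 2)) * indicator {0<..} s) \<partial>lborel"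
  shows "ennreal (truncated_powr p R x / 2) \<le> I"
    and "I \<le> ennreal (truncated_powr p R x / (p * (p - 1)))"
proof -
  \<comment> \<open>The factor \<open>s powr (2 - 2)\<close> is 1 for \<open>s > 0\<close>; it keeps
    the integrand in the shape of the hinge formula with exponent 2.\<close>
  have sq: "(\<integral>\<^sup>+s. ennreal c * (ennreal (x - s) * (ennreal (s powr (2 - 2)) * indicator {0<..} s)) \<partial>lborel)
      = ennreal (c * x\<^sup>2 / 2)" if "0 \<le> c" for c
    using nn_integral_hinge_powr[of x 2] x that
    by (subst nn_integral_cmult) (auto simp flip: ennreal_mult)
  have "ennreal (truncated_powr p R x / 2)
      = (\<integral>\<^sup>+s. ennreal (max R x powr (p - 2)) * (ennreal (x - s) * (ennreal (s powr (2 - 2)) * indicator {0<..} s)) \<partial>lborel)"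
    by (simp only: sq powr_ge_zero truncated_powr_def)
  also have "\<dots> \<le> I" unfolding I_def
  proof (rule nn_integral_mono)
    fix s :: real
    show "ennreal (max R x powr (p - 2)) * (ennreal (x - s) * (ennreal (s powr (2 - 2)) * indicator {0<..} s))
      \<le> ennreal (x - s) * (ennreal (max R s powr (p - 2)) * indicator {0<..} s)"
    proof (cases "0 < s \<and> s < x")
      case True
      then have "max R x powr (p - 2) \<le> max R s powr (p - 2)"
        using p R by (intro powr_mono2') auto
      then show ?thesis using True
        by (auto simp: mult.commute intro!: mult_left_mono ennreal_leI)
    qed (auto simp: ennreal_neg)
  qed
  finally show "ennreal (truncated_powr p R x / 2) \<le> I" .
  show "I \<le> ennreal (truncated_powr p R x / (p * (p - 1)))"
  proof (cases "x < R")
    case True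
    have "I \<le> (\<integral>\<^sup>+s. ennreal (R powr (p - 2)) * (ennreal (x - s) * (ennreal (s powr (2 - 2)) * indicator {0<..} s)) \<partial>lborel)"
      unfolding I_def
    proof (rule nn_integral_mono)
      fix s :: real
      have "max R s powr (p - 2) \<le> R powr (p - 2)"
        using p True x by (intro powr_mono2') auto
      then show "ennreal (x - s) * (ennreal (max R s powr (p - 2)) * indicator {0<..} s)
        \<le> ennreal (R powr (p - 2)) * (ennreal (x - s) * (ennreal (s powr (2 - 2)) * indicator {0<..} s))"
        by (auto simp: indicator_def mult.commute intro!: mult_left_mono ennreal_leI)
    qed
    also have "\<dots> = ennreal (truncated_powr p R x / 2)"
      using True by (simp only: sq powr_ge_zero truncated_powr_def) simp
    also have "\<dots> \<le> ennreal (truncated_powr p R x / (p * (p - 1)))"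
    proof (intro ennreal_leI divide_left_mono)
      have "p * (p - 1) \<le> 2 * 1" using p by (intro mult_mono) auto
      then show "p * (p - 1) \<le> 2" by simp
    qed (use p in \<open>auto simp: truncated_powr_nonneg\<close>)
    finally show ?thesis .
  next
    case False
    have "I \<le> (\<integral>\<^sup>+s. ennreal (x - s) * (ennreal (s powr (p - 2)) * indicator {0<..} s) \<partial>lborel)"
      unfolding I_def
    proof (rule nn_integral_mono)
      fix s :: real
      have "max R s powr (p - 2) \<le> s powr (p - 2)" if "0 < s"
        using p that by (intro powr_mono2') auto
      then show "ennreal (x - s) * (ennreal (max R s powr (p - 2)) * indicator {0<..} s)
        \<le> ennreal (x - s) * (ennreal (s powr (p - 2)) * indicator {0<..} s)"
        by (auto simp: indicator_def intro!: mult_left_mono ennreal_leI)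
    qed
    also have "\<dots> = ennreal (truncated_powr p R x / (p * (p - 1)))"
      using False x p by (simp add: nn_integral_hinge_powr truncated_powr_def max_def powr_minus_2_mult)
    finally show ?thesis .
  qed
qed

text \<open>A single time step: \<open>G\<close> stands for the past, \<open>X\<close> and
  \<open>Y\<close> for the absolute values of the next differences of \<open>e\<close> and
  \<open>d\<close>.\<close>

locale hinge_dominated = prob_space M for M :: "'a measure" +
  fixes G :: "'a measure" and X Y :: "'a \<Rightarrow> real"
  assumes subalgebra: "subalgebra M G"
    and X: "integrable M X" "\<And>\<omega>. 0 \<le> X \<omega>"
    and Y: "integrable M Y" "\<And>\<omega>. 0 \<le> Y \<omega>"
    and max_le: "\<And>s B. s \<in> borel_measurable G \<Longrightarrow> (\<And>\<omega>. 0 \<le> s \<omega> \<and> s \<omega> \<le> B) \<Longrightarrow>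
           (\<integral>\<omega>. max (s \<omega>) (X \<omega>) \<partial>M) \<le> (\<integral>\<omega>. max (s \<omega>) (Y \<omega>) \<partial>M)"
begin

lemma X_measurable [measurable]: "X \<in> borel_measurable M" and Y_measurable [measurable]: "Y \<in> borel_measurable M"
  using X Y by auto

text \<open>The threshold is \<open>c\<close> on \<open>A\<close> and a large constant elsewhere, which localizes the hypothesis to \<open>A\<close>.\<close>

lemma set_integral_hinge_le:
  assumes A: "A \<in> sets G" and c: "0 \<le> c"
  shows "(\<integral>\<omega>. indicator A \<omega> * max 0 (X \<omega> - c) \<partial>M) \<le> (\<integral>\<omega>. indicator A \<omega> * max 0 (Y \<omega> - c) \<partial>M)"
proof -
  have AM [measurable]: "A \<in> sets M" using A subalgebra by (auto simp: subalgebra_def)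
  note [measurable] = A
  have int: "integrable M (\<lambda>\<omega>. indicator B \<omega> * max 0 (Z \<omega> - b))"
    if Z: "integrable M Z" "\<And>\<omega>. 0 \<le> Z \<omega>" and b: "0 \<le> b" and [measurable]: "B \<in> sets M" for Z :: "'a \<Rightarrow> real" and b B
  proof (rule Bochner_Integration.integrable_bound[OF Z(1)])
    note [measurable] = borel_measurable_integrable[OF Z(1)]
    show "(\<lambda>\<omega>. indicator B \<omega> * max 0 (Z \<omega> - b)) \<in> borel_measurable M" by measurable
    show "AE \<omega> in M. norm (indicator B \<omega> * max 0 (Z \<omega> - b)) \<le> norm (Z \<omega>)"
      using Z(2) b by (auto simp: indicator_def max_def)
  qed
  \<comment> \<open>The maximum equals the threshold plus the excess over it, separately on
    \<open>A\<close> and off \<open>A\<close>. The integral of the threshold is the same for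
    \<open>X\<close> and \<open>Y\<close> and cancels.\<close>
  have split: "(\<integral>\<omega>. max (if \<omega> \<in> A then c else N) (Z \<omega>) \<partial>M)
      = (\<integral>\<omega>. (if \<omega> \<in> A then c else N) \<partial>M) + (\<integral>\<omega>. indicator A \<omega> * max 0 (Z \<omega> - c) \<partial>M)
        + (\<integral>\<omega>. indicator (space M - A) \<omega> * max 0 (Z \<omega> - N) \<partial>M)"
    if Z: "integrable M Z" "\<And>\<omega>. 0 \<le> Z \<omega>" and N: "0 \<le> N" for Z N
  proof -
    have 1: "integrable M (\<lambda>\<omega>. if \<omega> \<in> A then c else N)"
      by (rule integrable_const_bound[of _ "max c N"]) (use c N in \<open>auto simp: max_def\<close>)
    have "(\<integral>\<omega>. max (if \<omega> \<in> A then c else N) (Z \<omega>) \<partial>M)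
      = (\<integral>\<omega>. ((if \<omega> \<in> A then c else N) + indicator A \<omega> * max 0 (Z \<omega> - c))
        + indicator (space M - A) \<omega> * max 0 (Z \<omega> - N) \<partial>M)"
      by (intro Bochner_Integration.integral_cong) (auto simp: max_def)
    also have "\<dots> = (\<integral>\<omega>. (if \<omega> \<in> A then c else N) + indicator A \<omega> * max 0 (Z \<omega> - c) \<partial>M)
        + (\<integral>\<omega>. indicator (space M - A) \<omega> * max 0 (Z \<omega> - N) \<partial>M)"
      using Z N c 1 by (intro Bochner_Integration.integral_add Bochner_Integration.integrable_add int) auto
    also have "(\<integral>\<omega>. (if \<omega> \<in> A then c else N) + indicator A \<omega> * max 0 (Z \<omega> - c) \<partial>M)
        = (\<integral>\<omega>. (if \<omega> \<in> A then c else N) \<partial>M) + (\<integral>\<omega>. indicator A \<omega> * max 0 (Z \<omega> - c) \<partial>M)"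
      using Z N c 1 by (intro Bochner_Integration.integral_add int) auto
    finally show ?thesis .
  qed
  have le: "(\<integral>\<omega>. indicator A \<omega> * max 0 (X \<omega> - c) \<partial>M)
     \<le> (\<integral>\<omega>. indicator A \<omega> * max 0 (Y \<omega> - c) \<partial>M) + (\<integral>\<omega>. indicator (space M - A) \<omega> * max 0 (Y \<omega> - real N) \<partial>M)" for N
  proof -
    have "(\<integral>\<omega>. max (if \<omega> \<in> A then c else real N) (X \<omega>) \<partial>M) \<le> (\<integral>\<omega>. max (if \<omega> \<in> A then c else real N) (Y \<omega>) \<partial>M)"
      using c by (intro max_le[of _ "max c (real N)"]) auto
    moreover have "0 \<le> (\<integral>\<omega>. indicator (space M - A) \<omega> * max 0 (X \<omega> - real N) \<partial>M)"
      by (intro integral_nonneg_AE) auto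
    ultimately show ?thesis using split[OF X, of "real N"] split[OF Y, of "real N"] by linarith
  qed
  \<comment> \<open>The excess of \<open>X\<close> off \<open>A\<close> was dropped as nonnegative;
    that of \<open>Y\<close> disappears as \<open>N\<close> grows, by dominated convergence.\<close>
  have "(\<lambda>N. \<integral>\<omega>. indicator (space M - A) \<omega> * max 0 (Y \<omega> - real N) \<partial>M) \<longlonglongrightarrow> (\<integral>\<omega>. 0 \<partial>M)"
  proof (rule integral_dominated_convergence[OF _ _ Y(1)])
    show "AE \<omega> in M. (\<lambda>N. indicator (space M - A) \<omega> * max 0 (Y \<omega> - real N)) \<longlonglongrightarrow> 0"
    proof (rule AE_I2)
      fix \<omega>
      have "\<forall>\<^sub>F N in sequentially. Y \<omega> \<le> real N" by real_asymp
      then have "\<forall>\<^sub>F N in sequentially. 0 = indicator (space M - A) \<omega> * max 0 (Y \<omega> - real N)"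
        by eventually_elim auto
      then show "(\<lambda>N. indicator (space M - A) \<omega> * max 0 (Y \<omega> - real N)) \<longlonglongrightarrow> 0"
        by (rule Lim_transform_eventually[OF tendsto_const])
    qed
    show "AE \<omega> in M. norm (indicator (space M - A) \<omega> * max 0 (Y \<omega> - real N)) \<le> Y \<omega>" for N
      using Y(2) by (auto simp: indicator_def)
  qed measurable
  then have "(\<lambda>N. (\<integral>\<omega>. indicator A \<omega> * max 0 (Y \<omega> - c) \<partial>M) + (\<integral>\<omega>. indicator (space M - A) \<omega> * max 0 (Y \<omega> - real N) \<partial>M))
      \<longlonglongrightarrow> (\<integral>\<omega>. indicator A \<omega> * max 0 (Y \<omega> - c) \<partial>M) + 0"
    by (intro tendsto_add tendsto_const) simp
  then show ?thesis using le by (intro LIMSEQ_le_const[of _ _ "\<integral>\<omega>. indicator A \<omega> * max 0 (X \<omega> - c) \<partial>M"]) auto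
qed

text \<open>The inequality over all sets of \<open>G\<close> is an inequality between two measures
  on \<open>G\<close>, those with densities \<open>max 0 (X - c)\<close> and
  \<open>max 0 (Y - c)\<close>, and hence holds for integrals of nonnegative
  \<open>G\<close>-measurable functions.\<close>

lemma nn_integral_hinge_le:
  assumes w: "w \<in> borel_measurable G" and c: "0 \<le> c"
  shows "(\<integral>\<^sup>+\<omega>. ennreal (X \<omega> - c) * w \<omega> \<partial>M) \<le> (\<integral>\<^sup>+\<omega>. ennreal (Y \<omega> - c) * w \<omega> \<partial>M)"
proof -
  \<comment> \<open>Taking the image under the identity map into \<open>G\<close> restricts the
    measure to the smaller sigma-algebra.\<close>
  define \<mu> where "\<mu> Z = distr (density M (\<lambda>\<omega>. ennreal (Z \<omega> - c))) G (\<lambda>\<omega>. \<omega>)" for Z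
  have id: "(\<lambda>\<omega>. \<omega>) \<in> measurable M G"
    by (rule measurable_from_subalg[OF subalgebra]) simp
  have em: "emeasure (\<mu> Z) A = ennreal (\<integral>\<omega>. indicator A \<omega> * max 0 (Z \<omega> - c) \<partial>M)"
    if Z: "integrable M Z" "\<And>\<omega>. 0 \<le> Z \<omega>" and A: "A \<in> sets G" for Z A
  proof -
    note [measurable] = borel_measurable_integrable[OF Z(1)]
    have [measurable]: "A \<in> sets M" using A subalgebra by (auto simp: subalgebra_def)
    have "emeasure (\<mu> Z) A = (\<integral>\<^sup>+\<omega>. ennreal (Z \<omega> - c) * indicator A \<omega> \<partial>M)"
    proof -
      have "A \<inter> space M = A" using sets.sets_into_space[of A M] by auto
      then show ?thesis unfolding \<mu>_def
        using id A by (subst emeasure_distr) (auto simp: emeasure_density)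
    qed
    also have "\<dots> = (\<integral>\<^sup>+\<omega>. ennreal (indicator A \<omega> * max 0 (Z \<omega> - c)) \<partial>M)"
      by (intro nn_integral_cong) (auto simp: indicator_def max_def ennreal_neg)
    also have "\<dots> = ennreal (\<integral>\<omega>. indicator A \<omega> * max 0 (Z \<omega> - c) \<partial>M)"
    proof (rule nn_integral_eq_integral)
      show "integrable M (\<lambda>\<omega>. indicator A \<omega> * max 0 (Z \<omega> - c))"
        by (rule Bochner_Integration.integrable_bound[OF Z(1)])
           (use Z(2) c in \<open>auto simp: indicator_def max_def\<close>)
    qed auto
    finally show ?thesis .
  qed
  have le: "\<mu> X \<le> \<mu> Y"
    using set_integral_hinge_le[OF _ c] em[OF X] em[OF Y]
    by (subst le_measure) (auto simp: \<mu>_def intro!: ennreal_leI)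
  have eq: "(\<integral>\<^sup>+\<omega>. w \<omega> \<partial>\<mu> Z) = (\<integral>\<^sup>+\<omega>. ennreal (Z \<omega> - c) * w \<omega> \<partial>M)"
    if Z: "integrable M Z" for Z
  proof -
    note [measurable] = borel_measurable_integrable[OF Z]
    have wM [measurable]: "w \<in> borel_measurable M" by (rule measurable_from_subalg[OF subalgebra w])
    show ?thesis unfolding \<mu>_def using w id
      by (subst nn_integral_distr) (auto simp: nn_integral_density)
  qed
  have "(\<integral>\<^sup>+\<omega>. w \<omega> \<partial>\<mu> X) \<le> (\<integral>\<^sup>+\<omega>. w \<omega> \<partial>\<mu> Y)"
    by (rule nn_integral_mono_measure[OF _ le]) (simp add: \<mu>_def)
  then show ?thesis by (simp add: eq X Y)
qed

text \<open>Fubini: for each fixed threshold \<open>s\<close> the weight \<open>W s\<close> is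
  \<open>G\<close>-measurable, so the hinge inequality applies before integrating over
  \<open>s\<close>.\<close>

lemma nn_integral_hinge_mixture_le:
  assumes W: "(\<lambda>(s, \<omega>). W s \<omega>) \<in> borel_measurable (borel \<Otimes>\<^sub>M G)"
  shows "(\<integral>\<^sup>+\<omega>. \<integral>\<^sup>+s. ennreal (X \<omega> - s) * (W s \<omega> * indicator {0<..} s) \<partial>lborel \<partial>M)
       \<le> (\<integral>\<^sup>+\<omega>. \<integral>\<^sup>+s. ennreal (Y \<omega> - s) * (W s \<omega> * indicator {0<..} s) \<partial>lborel \<partial>M)"
proof -
  interpret P: pair_sigma_finite lborel M
    by (intro pair_sigma_finite.intro lborel.sigma_finite_measure_axioms) unfold_locales
  have id: "(\<lambda>x. x) \<in> measurable M G" by (rule measurable_from_subalg[OF subalgebra]) simp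
  have "(\<lambda>x. (fst x, snd x)) \<in> measurable (borel \<Otimes>\<^sub>M M) (borel \<Otimes>\<^sub>M G)"
    by (intro measurable_Pair measurable_fst measurable_compose[OF measurable_snd id])
  from measurable_compose[OF this W] have [measurable]: "(\<lambda>x. W (fst x) (snd x)) \<in> borel_measurable (borel \<Otimes>\<^sub>M M)"
    by simp
  have swap: "(\<integral>\<^sup>+\<omega>. \<integral>\<^sup>+s. ennreal (Z \<omega> - s) * (W s \<omega> * indicator {0<..} s) \<partial>lborel \<partial>M)
      = (\<integral>\<^sup>+s. \<integral>\<^sup>+\<omega>. ennreal (Z \<omega> - s) * (W s \<omega> * indicator {0<..} s) \<partial>M \<partial>lborel)"
    if [measurable]: "Z \<in> borel_measurable M" for Z
  proof -
    have "(\<lambda>x. ennreal (Z (snd x) - fst x) * (W (fst x) (snd x) * indicator {0<..} (fst x)))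
        \<in> borel_measurable (lborel \<Otimes>\<^sub>M M)"
      by measurable
    from P.Fubini'[of "\<lambda>s \<omega>. ennreal (Z \<omega> - s) * (W s \<omega> * indicator {0<..} s)"] this
    show ?thesis by (simp add: case_prod_beta')
  qed
  have "(\<integral>\<^sup>+\<omega>. ennreal (X \<omega> - s) * (W s \<omega> * indicator {0<..} s) \<partial>M)
      \<le> (\<integral>\<^sup>+\<omega>. ennreal (Y \<omega> - s) * (W s \<omega> * indicator {0<..} s) \<partial>M)" for s
  proof (cases "0 < s")
    case True
    have "(\<lambda>\<omega>. W s \<omega>) \<in> borel_measurable G"
      using measurable_compose[OF measurable_Pair1' W, of s] by simp
    with True show ?thesis by (intro nn_integral_hinge_le) auto
  qed auto
  then show ?thesis by (simp add: swap nn_integral_mono)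
qed

text \<open>The mixture with weight \<open>w \<omega> * s powr (q - 2)\<close> represents the
  weighted power exactly, so no constant is lost.\<close>

lemma nn_integral_powr_le:
  assumes q: "1 < q" and w [measurable]: "w \<in> borel_measurable G" and w0: "\<And>\<omega>. 0 \<le> w \<omega>"
  shows "(\<integral>\<^sup>+\<omega>. ennreal (w \<omega> * X \<omega> powr q) \<partial>M) \<le> (\<integral>\<^sup>+\<omega>. ennreal (w \<omega> * Y \<omega> powr q) \<partial>M)"
proof -
  have wM [measurable]: "w \<in> borel_measurable M" by (rule measurable_from_subalg[OF subalgebra w])
  have qq: "0 < q * (q - 1)" using q by simp
  have eq: "(\<integral>\<^sup>+\<omega>. ennreal (w \<omega> * Z \<omega> powr q) \<partial>M)
    = ennreal (q * (q - 1)) * (\<integral>\<^sup>+\<omega>. \<integral>\<^sup>+s. ennreal (Z \<omega> - s) * ((ennreal (w \<omega>) * ennreal (s powr (q - 2))) * indicator {0<..} s) \<partial>lborel \<partial>M)"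
    if Z: "\<And>\<omega>. 0 \<le> Z \<omega>" "Z \<in> borel_measurable M" for Z
  proof -
    note [measurable] = Z(2)
    have "(\<integral>\<^sup>+s. ennreal (Z \<omega> - s) * ((ennreal (w \<omega>) * ennreal (s powr (q - 2))) * indicator {0<..} s) \<partial>lborel)
        = ennreal (w \<omega> * Z \<omega> powr q / (q * (q - 1)))" for \<omega>
    proof -
      have "(\<integral>\<^sup>+s. ennreal (Z \<omega> - s) * ((ennreal (w \<omega>) * ennreal (s powr (q - 2))) * indicator {0<..} s) \<partial>lborel)
        = (\<integral>\<^sup>+s. ennreal (w \<omega>) * (ennreal (Z \<omega> - s) * (ennreal (s powr (q - 2)) * indicator {0<..} s)) \<partial>lborel)"
        by (intro nn_integral_cong) (simp add: mult_ac)
      also have "\<dots> = ennreal (w \<omega>) * ennreal (Z \<omega> powr q / (q * (q - 1)))"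
        using nn_integral_hinge_powr[OF Z(1) q] by (subst nn_integral_cmult) auto
      finally show ?thesis using w0 qq by (simp flip: ennreal_mult)
    qed
    then have "ennreal (q * (q - 1)) * (\<integral>\<^sup>+\<omega>. \<integral>\<^sup>+s. ennreal (Z \<omega> - s) * ((ennreal (w \<omega>) * ennreal (s powr (q - 2))) * indicator {0<..} s) \<partial>lborel \<partial>M)
       = (\<integral>\<^sup>+\<omega>. ennreal (q * (q - 1)) * ennreal (w \<omega> * Z \<omega> powr q / (q * (q - 1))) \<partial>M)"
      by (simp add: nn_integral_cmult)
    also have "\<dots> = (\<integral>\<^sup>+\<omega>. ennreal (w \<omega> * Z \<omega> powr q) \<partial>M)"
      using qq w0 q by (intro nn_integral_cong) (simp flip: ennreal_mult)
    finally show ?thesis by simp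
  qed
  show ?thesis
    unfolding eq[OF X(2) X_measurable] eq[OF Y(2) Y_measurable]
    by (intro mult_left_mono nn_integral_hinge_mixture_le) auto
qed

text \<open>The function of \<open>t\<close> is only equivalent to a mixture of hinges; the constant
  is the ratio of the two factors in that equivalence.\<close>

lemma nn_integral_truncated_powr_le:
  assumes p: "1 < p" "p \<le> 2" and R [measurable]: "R \<in> borel_measurable G" and R0: "\<And>\<omega>. 0 \<le> R \<omega>"
  shows "(\<integral>\<^sup>+\<omega>. ennreal (truncated_powr p (R \<omega>) (X \<omega>)) \<partial>M)
       \<le> ennreal (2 / (p * (p - 1))) * (\<integral>\<^sup>+\<omega>. ennreal (truncated_powr p (R \<omega>) (Y \<omega>)) \<partial>M)"
proof -
  have [measurable]: "R \<in> borel_measurable M" by (rule measurable_from_subalg[OF subalgebra R])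
  define \<Phi> where "\<Phi> Z = (\<integral>\<^sup>+\<omega>. \<integral>\<^sup>+s. ennreal (Z \<omega> - s) * (ennreal (max (R \<omega>) s powr (p - 2)) * indicator {0<..} s) \<partial>lborel \<partial>M)" for Z
  have pp: "0 < p * (p - 1)" using p by simp
  have const: "ennreal 2 * ennreal (t / (p * (p - 1))) = ennreal (2 / (p * (p - 1))) * ennreal t" if "0 \<le> t" for t :: real
    using that pp by (subst (1 2) ennreal_mult[symmetric]) auto
  have half: "ennreal t = ennreal 2 * ennreal (t / 2)" if "0 \<le> t" for t :: real
    using that by (subst ennreal_mult[symmetric]) auto
  have "(\<integral>\<^sup>+\<omega>. ennreal (truncated_powr p (R \<omega>) (X \<omega>)) \<partial>M)
      = (\<integral>\<^sup>+\<omega>. ennreal 2 * ennreal (truncated_powr p (R \<omega>) (X \<omega>) / 2) \<partial>M)"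
    by (intro nn_integral_cong half truncated_powr_nonneg)
  also have "\<dots> = ennreal 2 * (\<integral>\<^sup>+\<omega>. ennreal (truncated_powr p (R \<omega>) (X \<omega>) / 2) \<partial>M)"
    by (rule nn_integral_cmult) measurable
  also have "\<dots> \<le> ennreal 2 * \<Phi> X" unfolding \<Phi>_def
    by (intro mult_left_mono nn_integral_mono truncated_powr_hinge_bounds p X R0) auto
  also have "\<dots> \<le> ennreal 2 * \<Phi> Y" unfolding \<Phi>_def
    by (intro mult_left_mono nn_integral_hinge_mixture_le) auto
  also have "\<dots> \<le> ennreal 2 * (\<integral>\<^sup>+\<omega>. ennreal (truncated_powr p (R \<omega>) (Y \<omega>) / (p * (p - 1))) \<partial>M)" unfolding \<Phi>_def
    by (intro mult_left_mono nn_integral_mono truncated_powr_hinge_bounds p Y R0) auto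
  also have "\<dots> = (\<integral>\<^sup>+\<omega>. ennreal (2 / (p * (p - 1))) * ennreal (truncated_powr p (R \<omega>) (Y \<omega>)) \<partial>M)"
    by (subst nn_integral_cmult[symmetric]) (measurable, intro nn_integral_cong const truncated_powr_nonneg)
  also have "\<dots> = ennreal (2 / (p * (p - 1))) * (\<integral>\<^sup>+\<omega>. ennreal (truncated_powr p (R \<omega>) (Y \<omega>)) \<partial>M)"
    by (rule nn_integral_cmult) measurable
  finally show ?thesis .
qed

end

subsection \<open>Martingale differences in \<open>L\<^sup>p\<close>\<close>

definition Lp_space :: "'a measure \<Rightarrow> real \<Rightarrow> ('a \<Rightarrow> real) set" where
  "Lp_space M p = {X \<in> borel_measurable M. integrable M (\<lambda>\<omega>. \<bar>X \<omega>\<bar> powr p)}"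

lemma Lp_spaceD:
  assumes "X \<in> Lp_space M p"
  shows "X \<in> borel_measurable M" "integrable M (\<lambda>\<omega>. \<bar>X \<omega>\<bar> powr p)"
  using assms by (auto simp: Lp_space_def)

lemma integrable_Lp_bound:
  assumes "X \<in> Lp_space M p" "Y \<in> Lp_space M p" "Z \<in> borel_measurable M"
    and "\<And>\<omega>. \<bar>Z \<omega>\<bar> \<le> C * (\<bar>X \<omega>\<bar> powr p + \<bar>Y \<omega>\<bar> powr p)"
  shows "integrable M Z"
proof (rule Bochner_Integration.integrable_bound)
  show "integrable M (\<lambda>\<omega>. C * (\<bar>X \<omega>\<bar> powr p + \<bar>Y \<omega>\<bar> powr p))"
    using assms by (auto simp: Lp_space_def)
  show "AE \<omega> in M. norm (Z \<omega>) \<le> norm (C * (\<bar>X \<omega>\<bar> powr p + \<bar>Y \<omega>\<bar> powr p))"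
    using assms(4) by (auto intro: order_trans[OF _ abs_ge_self])
qed fact

lemma Lp_space_bound:
  assumes "0 \<le> p" "X \<in> Lp_space M p" "Y \<in> Lp_space M p" "Z \<in> borel_measurable M"
    and "\<And>\<omega>. \<bar>Z \<omega>\<bar> \<le> \<bar>X \<omega>\<bar> + \<bar>Y \<omega>\<bar>"
  shows "Z \<in> Lp_space M p"
proof -
  have "integrable M (\<lambda>\<omega>. \<bar>Z \<omega>\<bar> powr p)"
  proof (rule integrable_Lp_bound[OF assms(2,3), of _ "2 powr p"])
    show "\<bar>\<bar>Z \<omega>\<bar> powr p\<bar> \<le> 2 powr p * (\<bar>X \<omega>\<bar> powr p + \<bar>Y \<omega>\<bar> powr p)" for \<omega>
    proof -
      have "\<bar>Z \<omega>\<bar> powr p \<le> (\<bar>X \<omega>\<bar> + \<bar>Y \<omega>\<bar>) powr p"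
        using assms by (intro powr_mono2) auto
      also have "\<dots> \<le> 2 powr p * (\<bar>X \<omega>\<bar> powr p + \<bar>Y \<omega>\<bar> powr p)"
        using assms by (intro add_powr_le) auto
      finally show ?thesis by simp
    qed
  qed (use assms(4) in measurable)
  with assms(4) show ?thesis by (simp add: Lp_space_def)
qed

text \<open>In place of Hoelder's inequality, the pointwise bound of
  \<open>a powr r * b powr s\<close> by \<open>a powr (r + s) + b powr (r + s)\<close> suffices for
  integrability.\<close>

lemma integrable_Lp_mult:
  assumes "0 \<le> r" "0 \<le> s" "r + s = p" "X \<in> Lp_space M p" "Y \<in> Lp_space M p" "Z \<in> borel_measurable M"
    and "\<And>\<omega>. \<bar>Z \<omega>\<bar> \<le> \<bar>X \<omega>\<bar> powr r * \<bar>Y \<omega>\<bar> powr s"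
  shows "integrable M Z"
  by (rule integrable_Lp_bound[OF assms(4-6), of 1])
    (use assms(3) in \<open>auto intro!: order_trans[OF assms(7)] order_trans[OF powr_mult_powr_le_add[OF assms(1,2)]]\<close>)

lemma integral_le_of_nn_integral_le:
  assumes Y: "integrable M Y" "\<And>\<omega>. 0 \<le> Y \<omega>" and X: "X \<in> borel_measurable M" "\<And>\<omega>. 0 \<le> X \<omega>"
    and c: "0 \<le> c" and le: "(\<integral>\<^sup>+\<omega>. ennreal (X \<omega>) \<partial>M) \<le> ennreal c * (\<integral>\<^sup>+\<omega>. ennreal (Y \<omega>) \<partial>M)"
  shows "integrable M X" "(\<integral>\<omega>. X \<omega> \<partial>M) \<le> c * (\<integral>\<omega>. Y \<omega> \<partial>M)"
proof -
  have Y0: "0 \<le> (\<integral>\<omega>. Y \<omega> \<partial>M)" using Y by simp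
  have le': "(\<integral>\<^sup>+\<omega>. ennreal (X \<omega>) \<partial>M) \<le> ennreal (c * (\<integral>\<omega>. Y \<omega> \<partial>M))"
    using le Y c Y0 by (simp add: nn_integral_eq_integral ennreal_mult)
  then have "(\<integral>\<^sup>+\<omega>. ennreal (X \<omega>) \<partial>M) < \<infinity>" by (simp add: le_less_trans)
  then show int: "integrable M X" using X by (intro integrableI_nonneg) auto
  show "(\<integral>\<omega>. X \<omega> \<partial>M) \<le> c * (\<integral>\<omega>. Y \<omega> \<partial>M)"
    using le' X Y0 c by (simp add: nn_integral_eq_integral[OF int])
qed

locale martingale_differences = prob_space M for M :: "'a measure" +
  fixes F :: "nat \<Rightarrow> 'a measure" and x :: "nat \<Rightarrow> 'a \<Rightarrow> real"
  assumes filtration: "filtration (space M) F"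
    and subalgebra: "\<And>k. subalgebra M (F k)"
    and difference: "martingale_difference M F x"
begin

definition S :: "nat \<Rightarrow> 'a \<Rightarrow> real" where
  "S k \<omega> = (\<Sum>j=1..k. x j \<omega>)"

primrec S_max :: "nat \<Rightarrow> 'a \<Rightarrow> real" where
  "S_max 0 \<omega> = 0"
| "S_max (Suc k) \<omega> = max (S_max k \<omega>) \<bar>S (Suc k) \<omega>\<bar>"

lemma S_0 [simp]: "S 0 \<omega> = 0" and S_Suc: "S (Suc k) \<omega> = S k \<omega> + x (Suc k) \<omega>"
  by (simp_all add: S_def)

lemma S_max_nonneg: "0 \<le> S_max k \<omega>" and abs_S_le_S_max: "\<bar>S k \<omega>\<bar> \<le> S_max k \<omega>"
  by (induction k) auto

lemma measurable_M: "f \<in> borel_measurable (F k) \<Longrightarrow> f \<in> borel_measurable M"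
  by (rule measurable_from_subalg[OF subalgebra])

lemma measurable_F_mono: "f \<in> borel_measurable (F j) \<Longrightarrow> j \<le> k \<Longrightarrow> f \<in> borel_measurable (F k)"
  by (rule measurable_from_subalg[of _ "F j"])
    (use filtration in \<open>auto simp: subalgebra_def filtration_def\<close>)

lemma x_F: "x (Suc k) \<in> borel_measurable (F (Suc k))"
  and x_integrable: "integrable M (x (Suc k))"
  and x_cond_exp: "AE \<omega> in M. real_cond_exp M (F k) (x (Suc k)) \<omega> = 0"
  using difference unfolding martingale_difference_def by (force dest: spec[of _ "Suc k"])+

lemma S_F [measurable]: "S k \<in> borel_measurable (F k)"
proof (induction k)
  case (Suc k)
  have [measurable]: "S k \<in> borel_measurable (F (Suc k))" by (rule measurable_F_mono[OF Suc]) simp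
  note [measurable] = x_F[of k]
  show ?case unfolding S_Suc[abs_def] by measurable
qed (simp add: S_def)

lemma S_max_F [measurable]: "S_max k \<in> borel_measurable (F k)"
proof (induction k)
  case (Suc k)
  have [measurable]: "S_max k \<in> borel_measurable (F (Suc k))" by (rule measurable_F_mono[OF Suc]) simp
  show ?case unfolding S_max.simps(2)[abs_def] by measurable
qed simp

lemma x_M [measurable]: "x (Suc k) \<in> borel_measurable M" and S_M [measurable]: "S k \<in> borel_measurable M"
  and S_max_M [measurable]: "S_max k \<in> borel_measurable M"
  using x_F S_F S_max_F by (blast intro: measurable_M)+

lemma sigma_finite_subalgebra: "sigma_finite_subalgebra M (F k)"
  by (intro finite_measure_subalgebra_is_sigma_finite finite_measure_subalgebra.intro
      finite_measure_subalgebra_axioms.intro subalgebra finite_measure_axioms)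

text \<open>The factor \<open>g\<close> can be pulled into the conditional expectation given
  \<open>F k\<close>, which is 0.\<close>

lemma orthogonal:
  assumes g: "g \<in> borel_measurable (F k)" and int: "integrable M (\<lambda>\<omega>. g \<omega> * x (Suc k) \<omega>)"
  shows "(\<integral>\<omega>. g \<omega> * x (Suc k) \<omega> \<partial>M) = 0"
proof -
  interpret sub: sigma_finite_subalgebra M "F k" by (rule sigma_finite_subalgebra)
  note [measurable] = measurable_M[OF g]
  have "(\<integral>\<omega>. g \<omega> * x (Suc k) \<omega> \<partial>M) = (\<integral>\<omega>. g \<omega> * real_cond_exp M (F k) (x (Suc k)) \<omega> \<partial>M)"
    using sub.real_cond_exp_intg(2)[OF int g] by simp
  also have "\<dots> = (\<integral>\<omega>. 0 \<partial>M)"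
    using x_cond_exp[of k] by (intro integral_cong_AE) auto
  finally show ?thesis by simp
qed

lemma S_integrable: "integrable M (S k)"
proof (induction k)
  case (Suc k)
  then show ?case unfolding S_Suc[abs_def] using x_integrable by auto
qed (simp add: S_def)

text \<open>\<open>S k\<close> is the conditional expectation of \<open>S (Suc k)\<close>, so
  conditional Jensen for \<open>|x| powr p\<close> gives the moment.\<close>

lemma S_Lp_Suc:
  assumes p: "1 < p" and Lp: "S (Suc k) \<in> Lp_space M p"
  shows "S k \<in> Lp_space M p"
proof -
  interpret sub: sigma_finite_subalgebra M "F k" by (rule sigma_finite_subalgebra)
  have "AE \<omega> in M. real_cond_exp M (F k) (\<lambda>\<omega>. S k \<omega> + x (Suc k) \<omega>) \<omega>
          = real_cond_exp M (F k) (S k) \<omega> + real_cond_exp M (F k) (x (Suc k)) \<omega>"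
    by (rule sub.real_cond_exp_add[OF S_integrable x_integrable])
  moreover have "AE \<omega> in M. real_cond_exp M (F k) (S k) \<omega> = S k \<omega>"
    by (rule sub.real_cond_exp_F_meas[OF S_integrable S_F])
  ultimately have eq: "AE \<omega> in M. real_cond_exp M (F k) (S (Suc k)) \<omega> = S k \<omega>"
    using x_cond_exp[of k] unfolding S_Suc[abs_def] by eventually_elim simp
  have "integrable M (\<lambda>\<omega>. \<bar>real_cond_exp M (F k) (S (Suc k)) \<omega>\<bar> powr p)"
    using Lp by (intro sub.integrable_convex_cond_exp[where I = UNIV] S_integrable convex_on_abs_powr[OF p])
      (auto simp: Lp_space_def)
  then have "integrable M (\<lambda>\<omega>. \<bar>S k \<omega>\<bar> powr p)"
    by (rule integrable_cong_AE_imp) (use eq in \<open>auto elim!: eventually_mono\<close>)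
  then show ?thesis by (simp add: Lp_space_def)
qed

lemma S_Lp:
  assumes "1 < p" "S n \<in> Lp_space M p" "k \<le> n"
  shows "S k \<in> Lp_space M p"
  using assms(3,2) by (induction rule: dec_induct) (auto intro: S_Lp_Suc[OF assms(1)])

lemma x_Lp:
  assumes p: "1 < p" and Lp: "S (Suc k) \<in> Lp_space M p"
  shows "x (Suc k) \<in> Lp_space M p"
  by (rule Lp_space_bound[OF _ Lp S_Lp_Suc[OF p Lp]]) (use p in \<open>auto simp: S_Suc\<close>)

text \<open>Intended for \<open>e\<close>: there the domination gives moments of the differences,
  and the sums inherit them.\<close>

lemma S_Lp_of_x:
  assumes p: "1 < p" and Lp: "\<And>k. k < n \<Longrightarrow> x (Suc k) \<in> Lp_space M p" and k: "k \<le> n"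
  shows "S k \<in> Lp_space M p"
  using k
proof (induction k)
  case (Suc k)
  show ?case
    by (rule Lp_space_bound[OF _ Suc.IH Lp[of k]]) (use p Suc.prems in \<open>auto simp: S_Suc\<close>)
qed (use p in \<open>simp add: Lp_space_def S_def\<close>)

lemma S_max_Lp:
  assumes p: "1 < p" and Lp: "\<And>k. k \<le> n \<Longrightarrow> S k \<in> Lp_space M p" and k: "k \<le> n"
  shows "S_max k \<in> Lp_space M p"
  using k
proof (induction k)
  case (Suc k)
  show ?case
    by (rule Lp_space_bound[OF _ Suc.IH Lp[of "Suc k"]])
      (use p Suc.prems S_max_nonneg[of k] in \<open>auto simp: max_def simp del: S_M\<close>)
qed (use p in \<open>simp add: Lp_space_def\<close>)

lemma tangent_orthogonal:
  assumes p: "1 < p" and Lp: "S k \<in> Lp_space M p" "x (Suc k) \<in> Lp_space M p"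
  shows "integrable M (\<lambda>\<omega>. p * signed_powr (p - 1) (S k \<omega>) * x (Suc k) \<omega>)"
    and "(\<integral>\<omega>. p * signed_powr (p - 1) (S k \<omega>) * x (Suc k) \<omega> \<partial>M) = 0"
proof -
  have "integrable M (\<lambda>\<omega>. signed_powr (p - 1) (S k \<omega>) * x (Suc k) \<omega>)"
    by (rule integrable_Lp_mult[of "p - 1" 1 p, OF _ _ _ Lp])
      (use p in \<open>auto simp: abs_mult abs_signed_powr\<close>)
  then show *: "integrable M (\<lambda>\<omega>. p * signed_powr (p - 1) (S k \<omega>) * x (Suc k) \<omega>)"
    by (simp add: mult.assoc)
  show "(\<integral>\<omega>. p * signed_powr (p - 1) (S k \<omega>) * x (Suc k) \<omega> \<partial>M) = 0"
    by (rule orthogonal[OF _ *]) measurable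
qed

text \<open>Expectation of the second-order lower bound at \<open>S k\<close> with increment
  \<open>x (Suc k)\<close>; the linear term has mean 0.\<close>

lemma truncated_powr_increment:
  assumes p: "1 < p" "p \<le> 2" and Lp: "S (Suc k) \<in> Lp_space M p"
  shows "integrable M (\<lambda>\<omega>. truncated_powr p \<bar>S k \<omega>\<bar> \<bar>x (Suc k) \<omega>\<bar>)"
    and "p * (p - 1) / 2 * 2 powr (p - 2) * (\<integral>\<omega>. truncated_powr p \<bar>S k \<omega>\<bar> \<bar>x (Suc k) \<omega>\<bar> \<partial>M)
       \<le> (\<integral>\<omega>. \<bar>S (Suc k) \<omega>\<bar> powr p \<partial>M) - (\<integral>\<omega>. \<bar>S k \<omega>\<bar> powr p \<partial>M)"
proof -
  let ?c = "p * (p - 1) / 2 * 2 powr (p - 2)"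
  let ?\<psi> = "\<lambda>\<omega>. truncated_powr p \<bar>S k \<omega>\<bar> \<bar>x (Suc k) \<omega>\<bar>"
  have Lk: "S k \<in> Lp_space M p" and Lx: "x (Suc k) \<in> Lp_space M p"
    using S_Lp_Suc x_Lp p Lp by auto
  show int: "integrable M ?\<psi>"
    by (rule integrable_Lp_bound[OF Lx Lx, of _ "1 / 2"])
      (use truncated_powr_le[OF p(2)] in \<open>auto simp: truncated_powr_nonneg intro: order_trans\<close>)
  have "(\<integral>\<omega>. \<bar>S k \<omega>\<bar> powr p + p * signed_powr (p - 1) (S k \<omega>) * x (Suc k) \<omega> + ?c * ?\<psi> \<omega> \<partial>M)
      \<le> (\<integral>\<omega>. \<bar>S (Suc k) \<omega>\<bar> powr p \<partial>M)"
  proof (rule integral_mono)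
    fix \<omega>
    have "?c * ?\<psi> \<omega> \<le> p * (p - 1) / 2 * ((\<bar>S k \<omega>\<bar> + \<bar>x (Suc k) \<omega>\<bar>) powr (p - 2) * (x (Suc k) \<omega>)\<^sup>2)"
      using double_max_powr_le[OF p, of "S k \<omega>" "x (Suc k) \<omega>"] p
      unfolding truncated_powr_def mult.assoc by (intro mult_left_mono) auto
    then show "\<bar>S k \<omega>\<bar> powr p + p * signed_powr (p - 1) (S k \<omega>) * x (Suc k) \<omega> + ?c * ?\<psi> \<omega> \<le> \<bar>S (Suc k) \<omega>\<bar> powr p"
      using abs_powr_second_order(1)[OF p, of "S k \<omega>" "x (Suc k) \<omega>"] by (simp add: S_Suc)
  qed (use int tangent_orthogonal(1)[OF p(1) Lk Lx] Lp_spaceD(2)[OF Lp] Lp_spaceD(2)[OF Lk] in auto)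
  also have "(\<integral>\<omega>. \<bar>S k \<omega>\<bar> powr p + p * signed_powr (p - 1) (S k \<omega>) * x (Suc k) \<omega> + ?c * ?\<psi> \<omega> \<partial>M)
      = (\<integral>\<omega>. \<bar>S k \<omega>\<bar> powr p \<partial>M) + ?c * (\<integral>\<omega>. ?\<psi> \<omega> \<partial>M)"
    using int tangent_orthogonal[OF p(1) Lk Lx] Lp_spaceD(2)[OF Lk] by simp
  finally show "?c * (\<integral>\<omega>. ?\<psi> \<omega> \<partial>M) \<le> (\<integral>\<omega>. \<bar>S (Suc k) \<omega>\<bar> powr p \<partial>M) - (\<integral>\<omega>. \<bar>S k \<omega>\<bar> powr p \<partial>M)"
    by simp
qed

text \<open>The same argument with uniform convexity. Summed over \<open>k\<close>, it controls the
  moments of the single differences by the moment of the sum.\<close>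

lemma powr_increment:
  assumes p: "2 \<le> p" and Lp: "S (Suc k) \<in> Lp_space M p"
  shows "2 powr (1 - p) * (\<integral>\<omega>. \<bar>x (Suc k) \<omega>\<bar> powr p \<partial>M)
       \<le> (\<integral>\<omega>. \<bar>S (Suc k) \<omega>\<bar> powr p \<partial>M) - (\<integral>\<omega>. \<bar>S k \<omega>\<bar> powr p \<partial>M)"
proof -
  have p1: "1 < p" using p by simp
  have Lk: "S k \<in> Lp_space M p" and Lx: "x (Suc k) \<in> Lp_space M p"
    using S_Lp_Suc x_Lp p1 Lp by auto
  have "(\<integral>\<omega>. \<bar>S k \<omega>\<bar> powr p + p * signed_powr (p - 1) (S k \<omega>) * x (Suc k) \<omega> + 2 powr (1 - p) * \<bar>x (Suc k) \<omega>\<bar> powr p \<partial>M)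
      \<le> (\<integral>\<omega>. \<bar>S (Suc k) \<omega>\<bar> powr p \<partial>M)"
    by (rule integral_mono)
      (use tangent_orthogonal(1)[OF p1 Lk Lx] Lp_spaceD(2)[OF Lp] Lp_spaceD(2)[OF Lk] Lp_spaceD(2)[OF Lx]
        abs_powr_uniformly_convex[OF p] in \<open>auto simp: S_Suc\<close>)
  also have "(\<integral>\<omega>. \<bar>S k \<omega>\<bar> powr p + p * signed_powr (p - 1) (S k \<omega>) * x (Suc k) \<omega> + 2 powr (1 - p) * \<bar>x (Suc k) \<omega>\<bar> powr p \<partial>M)
      = (\<integral>\<omega>. \<bar>S k \<omega>\<bar> powr p \<partial>M) + 2 powr (1 - p) * (\<integral>\<omega>. \<bar>x (Suc k) \<omega>\<bar> powr p \<partial>M)"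
    using tangent_orthogonal[OF p1 Lk Lx] Lp_spaceD(2)[OF Lk] Lp_spaceD(2)[OF Lx] by simp
  finally show ?thesis by simp
qed

end

section \<open>Doob's maximal inequality\<close>

context martingale_differences
begin

text \<open>A pathwise form of Doob's inequality. For \<open>b < y\<close> the tangent inequality
  for the power \<open>p\<close> at \<open>b\<close> shows that
  \<open>b powr (p - 1) * y - (1 - 1 / p) * b powr p\<close> does not decrease when the old maximum
  \<open>b\<close> is replaced by \<open>y\<close>. The change in \<open>y\<close> is bounded below
  through \<open>|S + x| \<ge> |S| + sgn S * x\<close>, which produces a martingale
  transform.\<close>

lemma doob_pathwise:
  assumes p: "1 < p"
  shows "S_max k \<omega> powr (p - 1) * \<bar>S k \<omega>\<bar> - (1 - 1 / p) * S_max k \<omega> powr p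
       + S_max k \<omega> powr (p - 1) * sgn (S k \<omega>) * x (Suc k) \<omega>
     \<le> S_max (Suc k) \<omega> powr (p - 1) * \<bar>S (Suc k) \<omega>\<bar> - (1 - 1 / p) * S_max (Suc k) \<omega> powr p"
proof -
  define b where "b = S_max k \<omega>"
  define y where "y = \<bar>S (Suc k) \<omega>\<bar>"
  have b: "0 \<le> b" by (simp add: b_def S_max_nonneg)
  have "\<bar>S k \<omega>\<bar> + sgn (S k \<omega>) * x (Suc k) \<omega> \<le> y"
    unfolding y_def S_Suc by (auto simp: sgn_if)
  then have "b powr (p - 1) * (\<bar>S k \<omega>\<bar> + sgn (S k \<omega>) * x (Suc k) \<omega>) \<le> b powr (p - 1) * y"
    by (intro mult_left_mono) auto
  moreover have "b powr (p - 1) * y - (1 - 1 / p) * b powr p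
      \<le> max b y powr (p - 1) * y - (1 - 1 / p) * max b y powr p"
  proof (cases "y \<le> b")
    case False
    then have y: "b < y" "0 < y" using b by auto
    have pm: "t powr (p - 1) * t = t powr p" if "0 \<le> t" for t :: real
      using that by (cases "t = 0") (auto simp: powr_diff)
    have "b powr p + p * b powr (p - 1) * (y - b) \<le> y powr p"
      using abs_powr_tangent[OF p, of b "y - b"] b y by (simp add: signed_powr_nonneg)
    then have "p * (b powr (p - 1) * y) \<le> y powr p + (p - 1) * b powr p"
      by (simp add: pm[OF b, symmetric] algebra_simps)
    then have "b powr (p - 1) * y \<le> (y powr p + (p - 1) * b powr p) / p"
      using p by (simp add: field_simps)
    also have "\<dots> = y powr p - (1 - 1 / p) * y powr p + (1 - 1 / p) * b powr p"
      using p by (simp add: field_simps)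
    finally have "b powr (p - 1) * y \<le> y powr (p - 1) * y - (1 - 1 / p) * y powr p + (1 - 1 / p) * b powr p"
      using y by (simp only: pm less_imp_le)
    then show ?thesis using y by (simp add: max_def)
  qed (simp add: max_def)
  ultimately show ?thesis by (simp add: b_def y_def algebra_simps)
qed

text \<open>The expectation of the pathwise functional starts at 0 and does not decrease, since the
  transform term has mean 0. The constant is \<open>2 powr p\<close> times Doob's sharp one, which
  is harmless here.\<close>

lemma doob_maximal:
  assumes p: "1 < p" and Lp: "\<And>k. k \<le> n \<Longrightarrow> S k \<in> Lp_space M p"
  shows "(\<integral>\<omega>. S_max n \<omega> powr p \<partial>M) \<le> ((1 - 1 / p) / 2) powr (- p) * (\<integral>\<omega>. \<bar>S n \<omega>\<bar> powr p \<partial>M)"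
proof -
  define \<epsilon> where "\<epsilon> = (1 - 1 / p) / 2"
  have \<epsilon>: "0 < \<epsilon>" "1 - 1 / p = 2 * \<epsilon>" using p by (auto simp: \<epsilon>_def)
  have max: "integrable M (\<lambda>\<omega>. S_max k \<omega> powr p)" if "k \<le> n" for k
    using Lp_spaceD(2)[OF S_max_Lp[OF p Lp that]] by (simp add: abs_of_nonneg S_max_nonneg)
  have mix: "integrable M (\<lambda>\<omega>. S_max k \<omega> powr (p - 1) * \<bar>S k \<omega>\<bar>)" if "k \<le> n" for k
    by (rule integrable_Lp_mult[of "p - 1" 1 p, OF _ _ _ S_max_Lp[OF p Lp that] Lp[OF that]])
      (use p in \<open>auto simp: abs_mult abs_of_nonneg S_max_nonneg\<close>)
  have "0 \<le> (\<integral>\<omega>. S_max k \<omega> powr (p - 1) * \<bar>S k \<omega>\<bar> - 2 * \<epsilon> * S_max k \<omega> powr p \<partial>M)" if "k \<le> n" for k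
    using that
  proof (induction k)
    case (Suc k)
    have Lk: "S_max k \<in> Lp_space M p" "x (Suc k) \<in> Lp_space M p"
      using S_max_Lp[OF p Lp, of n k] x_Lp[OF p, of k] Lp[of "Suc k"] Suc.prems by auto
    have int: "integrable M (\<lambda>\<omega>. S_max k \<omega> powr (p - 1) * sgn (S k \<omega>) * x (Suc k) \<omega>)"
      by (rule integrable_Lp_mult[of "p - 1" 1 p, OF _ _ _ Lk])
        (use p in \<open>auto simp: abs_mult abs_of_nonneg S_max_nonneg abs_sgn_eq\<close>)
    have zero: "(\<integral>\<omega>. S_max k \<omega> powr (p - 1) * sgn (S k \<omega>) * x (Suc k) \<omega> \<partial>M) = 0"
      by (rule orthogonal[OF _ int]) measurable
    have "0 \<le> (\<integral>\<omega>. S_max k \<omega> powr (p - 1) * \<bar>S k \<omega>\<bar> - 2 * \<epsilon> * S_max k \<omega> powr p \<partial>M)"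
      using Suc by simp
    also have "\<dots> = (\<integral>\<omega>. S_max k \<omega> powr (p - 1) * \<bar>S k \<omega>\<bar> - 2 * \<epsilon> * S_max k \<omega> powr p
           + S_max k \<omega> powr (p - 1) * sgn (S k \<omega>) * x (Suc k) \<omega> \<partial>M)"
      using zero int max[of k] mix[of k] Suc.prems by simp
    also have "\<dots> \<le> (\<integral>\<omega>. S_max (Suc k) \<omega> powr (p - 1) * \<bar>S (Suc k) \<omega>\<bar> - 2 * \<epsilon> * S_max (Suc k) \<omega> powr p \<partial>M)"
    proof (rule integral_mono)
      show "integrable M (\<lambda>\<omega>. S_max (Suc k) \<omega> powr (p - 1) * \<bar>S (Suc k) \<omega>\<bar> - 2 * \<epsilon> * S_max (Suc k) \<omega> powr p)"
        by (intro Bochner_Integration.integrable_diff integrable_mult_right mix max Suc.prems)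
      show "integrable M (\<lambda>\<omega>. S_max k \<omega> powr (p - 1) * \<bar>S k \<omega>\<bar> - 2 * \<epsilon> * S_max k \<omega> powr p
           + S_max k \<omega> powr (p - 1) * sgn (S k \<omega>) * x (Suc k) \<omega>)"
        using int max[of k] mix[of k] Suc.prems by simp
    qed (rule doob_pathwise[OF p, unfolded \<epsilon>(2)])
    finally show ?case .
  qed simp
  from this[OF order_refl] have "2 * \<epsilon> * (\<integral>\<omega>. S_max n \<omega> powr p \<partial>M) \<le> (\<integral>\<omega>. S_max n \<omega> powr (p - 1) * \<bar>S n \<omega>\<bar> \<partial>M)"
    using max[of n] mix[of n] by simp
  \<comment> \<open>Young's inequality is applied with half of the coefficient
    \<open>2 * \<epsilon>\<close>, so that the other half survives on the left.\<close>
  also have "\<dots> \<le> (\<integral>\<omega>. \<epsilon> * S_max n \<omega> powr p + \<epsilon> powr (1 - p) * \<bar>S n \<omega>\<bar> powr p \<partial>M)"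
  proof (rule integral_mono[OF mix])
    show "integrable M (\<lambda>\<omega>. \<epsilon> * S_max n \<omega> powr p + \<epsilon> powr (1 - p) * \<bar>S n \<omega>\<bar> powr p)"
      using max[of n] Lp_spaceD(2)[OF Lp, of n] by simp
    show "S_max n \<omega> powr (p - 1) * \<bar>S n \<omega>\<bar> \<le> \<epsilon> * S_max n \<omega> powr p + \<epsilon> powr (1 - p) * \<bar>S n \<omega>\<bar> powr p" for \<omega>
      using powr_mult_powr_le[of "p - 1" 1 \<epsilon> "S_max n \<omega>" "\<bar>S n \<omega>\<bar>"] p \<epsilon> S_max_nonneg by simp
  qed simp
  also have "\<dots> = \<epsilon> * (\<integral>\<omega>. S_max n \<omega> powr p \<partial>M) + \<epsilon> powr (1 - p) * (\<integral>\<omega>. \<bar>S n \<omega>\<bar> powr p \<partial>M)"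
    using max[of n] Lp_spaceD(2)[OF Lp, of n] by simp
  finally have "\<epsilon> * (\<integral>\<omega>. S_max n \<omega> powr p \<partial>M) \<le> \<epsilon> * (\<epsilon> powr (- p) * (\<integral>\<omega>. \<bar>S n \<omega>\<bar> powr p \<partial>M))"
    using \<epsilon>(1) by (simp add: powr_diff powr_minus divide_inverse)
  then show ?thesis using \<epsilon>(1) by (simp add: \<epsilon>_def)
qed

end

subsection \<open>Moment comparison\<close>

text \<open>Numerator: the factor in the upper bound for the increments of the pair. Denominator:
  the factor in the lower bound for the increments of \<open>d.S\<close>.\<close>

definition const_le_2 :: "real \<Rightarrow> real" where
  "const_le_2 p = 6 * (1 + 2 / (p * (p - 1))) / (p * (p - 1) / 2 * 2 powr (p - 2))"

locale dominated_differences = d: martingale_differences M F d + e: martingale_differences M F e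
  for M :: "'a measure" and F d e +
  assumes dominated: "max_dominated M F e d"
begin

lemma hinge_dominated: "hinge_dominated M (F k) (\<lambda>\<omega>. \<bar>e (Suc k) \<omega>\<bar>) (\<lambda>\<omega>. \<bar>d (Suc k) \<omega>\<bar>)"
proof
  fix s :: "'a \<Rightarrow> real" and B assume s: "s \<in> borel_measurable (F k)" "\<And>\<omega>. 0 \<le> s \<omega> \<and> s \<omega> \<le> B"
  \<comment> \<open>A predictable sequence that is nonzero only at \<open>Suc k\<close> isolates one
    time step; there predictability means measurability with respect to \<open>F k\<close>.\<close>
  define s' where "s' j = (if j = Suc k then s else (\<lambda>_. 0))" for j
  have "predictable F s'"
    using s(1) by (auto simp: predictable_def s'_def)
  moreover have "bounded_nonneg M s'"
    unfolding bounded_nonneg_def s'_def using s(2) order_trans[of 0 "s _" B] by (intro exI[of _ B]) auto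
  ultimately show "(\<integral>\<omega>. max (s \<omega>) \<bar>e (Suc k) \<omega>\<bar> \<partial>M) \<le> (\<integral>\<omega>. max (s \<omega>) \<bar>d (Suc k) \<omega>\<bar> \<partial>M)"
    using dominated[unfolded max_dominated_def, rule_format, of s' "Suc k"] by (simp add: s'_def)
qed (use d.subalgebra d.x_integrable e.x_integrable in auto)

lemma weighted_powr_le:
  assumes q: "1 < q" and w: "w \<in> borel_measurable (F k)" "\<And>\<omega>. 0 \<le> w \<omega>"
    and int: "integrable M (\<lambda>\<omega>. w \<omega> * \<bar>d (Suc k) \<omega>\<bar> powr q)"
  shows "integrable M (\<lambda>\<omega>. w \<omega> * \<bar>e (Suc k) \<omega>\<bar> powr q)"
    and "(\<integral>\<omega>. w \<omega> * \<bar>e (Suc k) \<omega>\<bar> powr q \<partial>M) \<le> (\<integral>\<omega>. w \<omega> * \<bar>d (Suc k) \<omega>\<bar> powr q \<partial>M)"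
proof -
  interpret hinge_dominated M "F k" "\<lambda>\<omega>. \<bar>e (Suc k) \<omega>\<bar>" "\<lambda>\<omega>. \<bar>d (Suc k) \<omega>\<bar>"
    by (rule hinge_dominated)
  have [measurable]: "w \<in> borel_measurable M" by (rule d.measurable_M[OF w(1)])
  have "(\<integral>\<^sup>+\<omega>. ennreal (w \<omega> * \<bar>e (Suc k) \<omega>\<bar> powr q) \<partial>M) \<le> ennreal 1 * (\<integral>\<^sup>+\<omega>. ennreal (w \<omega> * \<bar>d (Suc k) \<omega>\<bar> powr q) \<partial>M)"
    using nn_integral_powr_le[OF q w] by simp
  from integral_le_of_nn_integral_le[OF int _ _ _ _ this] w(2)
  show "integrable M (\<lambda>\<omega>. w \<omega> * \<bar>e (Suc k) \<omega>\<bar> powr q)"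
    "(\<integral>\<omega>. w \<omega> * \<bar>e (Suc k) \<omega>\<bar> powr q \<partial>M) \<le> (\<integral>\<omega>. w \<omega> * \<bar>d (Suc k) \<omega>\<bar> powr q \<partial>M)"
    by auto
qed

lemma e_Lp:
  assumes "1 < p" "d (Suc k) \<in> Lp_space M p"
  shows "e (Suc k) \<in> Lp_space M p" "(\<integral>\<omega>. \<bar>e (Suc k) \<omega>\<bar> powr p \<partial>M) \<le> (\<integral>\<omega>. \<bar>d (Suc k) \<omega>\<bar> powr p \<partial>M)"
  using weighted_powr_le[of p "\<lambda>_. 1" k] assms by (auto simp: Lp_space_def)

text \<open>The moment of \<open>d.S n\<close> passes to earlier sums, then to the differences of
  \<open>d\<close>, by domination to those of \<open>e\<close>, and finally to the sums of
  \<open>e\<close>. This gives the integrability on which the later estimates rest.\<close>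

lemma e_S_Lp:
  assumes p: "1 < p" and Lp: "d.S n \<in> Lp_space M p" and k: "k \<le> n"
  shows "e.S k \<in> Lp_space M p"
  by (rule e.S_Lp_of_x[OF p _ k]) (auto intro!: e_Lp p d.x_Lp d.S_Lp[OF p Lp])

section \<open>Exponents at most 2\<close>

text \<open>Working with the pair instead of \<open>e.S\<close> alone makes the scale
  \<open>R\<close> at least \<open>|d.S k|\<close>. Without this, the quadratic terms in
  \<open>d\<close> at the scale \<open>|e.S k|\<close> could not be compared with those at the scale
  \<open>|d.S k|\<close>.\<close>

lemma norm_powr_increment:
  assumes p: "1 < p" "p \<le> 2" and Lp: "d.S (Suc k) \<in> Lp_space M p"
    and Le: "e.S k \<in> Lp_space M p"
  defines "N \<equiv> \<lambda>k. \<integral>\<omega>. norm (d.S k \<omega>, e.S k \<omega>) powr p \<partial>M"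
  shows "N (Suc k) - N k \<le> 6 * (1 + 2 / (p * (p - 1))) * (\<integral>\<omega>. truncated_powr p \<bar>d.S k \<omega>\<bar> \<bar>d (Suc k) \<omega>\<bar> \<partial>M)"
proof -
  define R where "R \<omega> = norm (d.S k \<omega>, e.S k \<omega>)" for \<omega>
  let ?d = "d (Suc k)" and ?e = "e (Suc k)"
  let ?\<psi> = "\<lambda>X \<omega>. truncated_powr p (R \<omega>) \<bar>X \<omega>\<bar>"
  let ?K = "2 / (p * (p - 1))"
  have K: "0 \<le> ?K" using p by simp
  have R0: "0 \<le> R \<omega>" for \<omega> by (simp add: R_def)
  have RF [measurable]: "R \<in> borel_measurable (F k)"
    unfolding R_def[abs_def] norm_Pair by measurable
  have [measurable]: "R \<in> borel_measurable M" by (rule d.measurable_M[OF RF])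
  have Ld: "d.S k \<in> Lp_space M p" "?d \<in> Lp_space M p" using d.S_Lp_Suc d.x_Lp p Lp by auto
  have Lx: "?e \<in> Lp_space M p" by (rule e_Lp[OF p(1) Ld(2)])
  have Le': "e.S (Suc k) \<in> Lp_space M p"
    by (rule Lp_space_bound[OF _ Le Lx]) (use p in \<open>auto simp: e.S_Suc\<close>)
  have Rle: "R \<omega> \<le> \<bar>d.S k \<omega>\<bar> + \<bar>e.S k \<omega>\<bar>" for \<omega>
    unfolding R_def by (rule order_trans[OF norm_Pair_le]) simp
  have dR: "\<bar>d.S k \<omega>\<bar> \<le> R \<omega>" "\<bar>e.S k \<omega>\<bar> \<le> R \<omega>" for \<omega>
    by (simp_all add: R_def norm_Pair real_le_rsqrt)
  have LR: "R \<in> Lp_space M p"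
    by (rule Lp_space_bound[OF _ Ld(1) Le]) (use p Rle R0 in auto)
  have intN: "integrable M (\<lambda>\<omega>. norm (d.S j \<omega>, e.S j \<omega>) powr p)"
    if "d.S j \<in> Lp_space M p" "e.S j \<in> Lp_space M p" for j
  proof -
    have "(\<lambda>\<omega>. norm (d.S j \<omega>, e.S j \<omega>)) \<in> Lp_space M p"
    proof (rule Lp_space_bound[OF _ that])
      show "(\<lambda>\<omega>. norm (d.S j \<omega>, e.S j \<omega>)) \<in> borel_measurable M" unfolding norm_Pair by measurable
      show "\<bar>norm (d.S j \<omega>, e.S j \<omega>)\<bar> \<le> \<bar>d.S j \<omega>\<bar> + \<bar>e.S j \<omega>\<bar>" for \<omega>
        using norm_Pair_le[of "d.S j \<omega>" "e.S j \<omega>"] by simp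
    qed (use p in simp)
    from Lp_spaceD(2)[OF this] show ?thesis by simp
  qed
  have psi_int: "integrable M (?\<psi> X)" if "X \<in> Lp_space M p" for X
    by (rule integrable_Lp_bound[OF that that, of _ "1 / 2"])
      (use truncated_powr_le[OF p(2)] R0 Lp_spaceD(1)[OF that] in \<open>auto simp: truncated_powr_nonneg\<close>)
  \<comment> \<open>The factor \<open>R powr (p - 2)\<close> may be large for small
    \<open>R\<close>, but \<open>|Y| \<le> R\<close> turns it into \<open>R powr (p - 1)\<close>; at
    \<open>R = 0\<close> both powers are 0 by convention.\<close>
  have orth: "integrable M (\<lambda>\<omega>. p * R \<omega> powr (p - 2) * Y \<omega> * X \<omega>)"
    if "X \<in> Lp_space M p" "Y \<in> borel_measurable M" "\<And>\<omega>. \<bar>Y \<omega>\<bar> \<le> R \<omega>" for X Y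
  proof -
    note [measurable] = Lp_spaceD(1)[OF that(1)] that(2)
    have "integrable M (\<lambda>\<omega>. R \<omega> powr (p - 2) * Y \<omega> * X \<omega>)"
    proof (rule integrable_Lp_mult[of "p - 1" 1 p, OF _ _ _ LR that(1)])
      fix \<omega>
      have "R \<omega> powr (p - 2) * \<bar>Y \<omega>\<bar> * \<bar>X \<omega>\<bar> \<le> R \<omega> powr (p - 2) * R \<omega> * \<bar>X \<omega>\<bar>"
        using that(3) by (intro mult_right_mono mult_left_mono) auto
      also have "R \<omega> powr (p - 2) * R \<omega> = R \<omega> powr (p - 1)"
        using R0[of \<omega>] by (cases "R \<omega> = 0") (auto simp: powr_diff power2_eq_square)
      finally show "\<bar>R \<omega> powr (p - 2) * Y \<omega> * X \<omega>\<bar> \<le> \<bar>R \<omega>\<bar> powr (p - 1) * \<bar>X \<omega>\<bar> powr 1"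
        using R0[of \<omega>] by (simp add: abs_mult)
    qed (use p in auto)
    from integrable_mult_right[OF this, of p] show ?thesis by (simp add: mult.assoc)
  qed
  note orth_d = orth[OF Ld(2) d.S_M dR(1)] and orth_e = orth[OF Lx e.S_M dR(2)]
  have zero: "(\<integral>\<omega>. p * R \<omega> powr (p - 2) * d.S k \<omega> * ?d \<omega> \<partial>M) = 0"
      "(\<integral>\<omega>. p * R \<omega> powr (p - 2) * e.S k \<omega> * ?e \<omega> \<partial>M) = 0"
    by (rule d.orthogonal[OF _ orth_d], measurable) (rule e.orthogonal[OF _ orth_e], measurable)
  have "N (Suc k) \<le> (\<integral>\<omega>. R \<omega> powr p + p * R \<omega> powr (p - 2) * d.S k \<omega> * ?d \<omega> + p * R \<omega> powr (p - 2) * e.S k \<omega> * ?e \<omega>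
      + 6 * (?\<psi> ?d \<omega> + ?\<psi> ?e \<omega>) \<partial>M)"
    unfolding N_def
  proof (rule integral_mono[OF intN[OF Lp Le']])
    show "integrable M (\<lambda>\<omega>. R \<omega> powr p + p * R \<omega> powr (p - 2) * d.S k \<omega> * ?d \<omega> + p * R \<omega> powr (p - 2) * e.S k \<omega> * ?e \<omega>
      + 6 * (?\<psi> ?d \<omega> + ?\<psi> ?e \<omega>))"
      using intN[OF Ld(1) Le] orth_d orth_e psi_int[OF Ld(2)] psi_int[OF Lx] by (simp add: R_def)
    fix \<omega>
    define H where "H = norm (?d \<omega>, ?e \<omega>)"
    have H: "\<bar>?d \<omega>\<bar> \<le> H" "\<bar>?e \<omega>\<bar> \<le> H" "H\<^sup>2 = \<bar>?d \<omega>\<bar>\<^sup>2 + \<bar>?e \<omega>\<bar>\<^sup>2"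
      by (simp_all add: H_def norm_Pair real_le_rsqrt)
    \<comment> \<open>Lowering \<open>H\<close> to a component \<open>h\<close> increases the power
      of nonpositive exponent. With \<open>H^2\<close> split into the two squares, the remainder
      separates into a term in \<open>d\<close> and a term in \<open>e\<close>.\<close>
    have anti: "max (R \<omega>) H powr (p - 2) * h\<^sup>2 \<le> truncated_powr p (R \<omega>) h" if "0 \<le> h" "h \<le> H" for h
    proof (cases "h = 0")
      case False
      then show ?thesis unfolding truncated_powr_def
        using that p by (intro mult_right_mono powr_mono2') auto
    qed (simp add: truncated_powr_def)
    have "max (R \<omega>) H powr (p - 2) * H\<^sup>2 \<le> ?\<psi> ?d \<omega> + ?\<psi> ?e \<omega>"
      using anti[of "\<bar>?d \<omega>\<bar>"] anti[of "\<bar>?e \<omega>\<bar>"] H by (simp add: distrib_left)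
    then show "norm (d.S (Suc k) \<omega>, e.S (Suc k) \<omega>) powr p
      \<le> R \<omega> powr p + p * R \<omega> powr (p - 2) * d.S k \<omega> * ?d \<omega> + p * R \<omega> powr (p - 2) * e.S k \<omega> * ?e \<omega>
      + 6 * (?\<psi> ?d \<omega> + ?\<psi> ?e \<omega>)"
      using norm_powr_second_order[OF p, of "(d.S k \<omega>, e.S k \<omega>)" "(?d \<omega>, ?e \<omega>)"]
      by (simp add: R_def H_def d.S_Suc e.S_Suc distrib_left mult.assoc)
  qed
  also have "\<dots> = N k + 6 * ((\<integral>\<omega>. ?\<psi> ?d \<omega> \<partial>M) + (\<integral>\<omega>. ?\<psi> ?e \<omega> \<partial>M))"
    using intN[OF Ld(1) Le] orth_d orth_e psi_int[OF Ld(2)] psi_int[OF Lx] zero by (simp add: R_def N_def)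
  also have "(\<integral>\<omega>. ?\<psi> ?e \<omega> \<partial>M) \<le> ?K * (\<integral>\<omega>. ?\<psi> ?d \<omega> \<partial>M)"
  proof -
    interpret hinge_dominated M "F k" "\<lambda>\<omega>. \<bar>e (Suc k) \<omega>\<bar>" "\<lambda>\<omega>. \<bar>d (Suc k) \<omega>\<bar>"
      by (rule hinge_dominated)
    show ?thesis
      by (rule integral_le_of_nn_integral_le(2)[OF psi_int[OF Ld(2)] _ _ _ K nn_integral_truncated_powr_le[OF p RF R0]])
        (auto simp: truncated_powr_nonneg)
  qed
  also have "N k + 6 * ((\<integral>\<omega>. ?\<psi> ?d \<omega> \<partial>M) + ?K * (\<integral>\<omega>. ?\<psi> ?d \<omega> \<partial>M)) = N k + 6 * (1 + ?K) * (\<integral>\<omega>. ?\<psi> ?d \<omega> \<partial>M)"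
    by (simp add: algebra_simps)
  \<comment> \<open>Here the scale drops from \<open>R\<close> to \<open>|d.S k|\<close>, which
    increases the truncated power.\<close>
  also have "(\<integral>\<omega>. ?\<psi> ?d \<omega> \<partial>M) \<le> (\<integral>\<omega>. truncated_powr p \<bar>d.S k \<omega>\<bar> \<bar>?d \<omega>\<bar> \<partial>M)"
    by (rule integral_mono[OF psi_int[OF Ld(2)] d.truncated_powr_increment(1)[OF p Lp]])
      (use truncated_powr_antimono[OF p(2)] dR in auto)
  finally show ?thesis using K by (simp add: mult_left_mono)
qed

text \<open>Both moment sequences vanish at 0, and each increment for the pair is at most
  \<open>b / a\<close> times the increment for \<open>d.S\<close>; the sums telescope.\<close>

lemma moment_le_2:
  assumes p: "1 < p" "p \<le> 2" and Lp: "d.S n \<in> Lp_space M p"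
  shows "(\<integral>\<omega>. \<bar>e.S n \<omega>\<bar> powr p \<partial>M) \<le> const_le_2 p * (\<integral>\<omega>. \<bar>d.S n \<omega>\<bar> powr p \<partial>M)"
proof -
  let ?N = "\<lambda>k. \<integral>\<omega>. norm (d.S k \<omega>, e.S k \<omega>) powr p \<partial>M"
  let ?B = "\<lambda>k. \<integral>\<omega>. \<bar>d.S k \<omega>\<bar> powr p \<partial>M"
  define a where "a = p * (p - 1) / 2 * 2 powr (p - 2)"
  define b where "b = 6 * (1 + 2 / (p * (p - 1)))"
  have ab: "0 < a" "0 < b" "const_le_2 p = b / a" using p by (auto simp: a_def b_def const_le_2_def intro!: add_pos_nonneg)
  have "?N k \<le> b / a * ?B k" if "k \<le> n" for k
    using that
  proof (induction k)
    case (Suc k)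
    let ?I = "\<integral>\<omega>. truncated_powr p \<bar>d.S k \<omega>\<bar> \<bar>d (Suc k) \<omega>\<bar> \<partial>M"
    have "?N (Suc k) - ?N k \<le> b * ?I"
      unfolding b_def using Suc.prems
      by (intro norm_powr_increment p d.S_Lp[OF p(1) Lp] e_S_Lp[OF p(1) Lp]) auto
    also have "\<dots> = b / a * (a * ?I)" using ab by simp
    also have "\<dots> \<le> b / a * (?B (Suc k) - ?B k)"
      unfolding a_def[symmetric] using ab Suc.prems
      by (intro mult_left_mono d.truncated_powr_increment(2)[OF p d.S_Lp[OF p(1) Lp], folded a_def]) auto
    finally show ?case using Suc by (simp add: right_diff_distrib)
  qed simp
  moreover have "(\<integral>\<omega>. \<bar>e.S n \<omega>\<bar> powr p \<partial>M) \<le> ?N n"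
  proof (rule integral_mono)
    have Le: "e.S n \<in> Lp_space M p" by (rule e_S_Lp[OF p(1) Lp]) simp
    show "integrable M (\<lambda>\<omega>. \<bar>e.S n \<omega>\<bar> powr p)" by (rule Lp_spaceD(2)[OF Le])
    have "(\<lambda>\<omega>. norm (d.S n \<omega>, e.S n \<omega>)) \<in> Lp_space M p"
    proof (rule Lp_space_bound[OF _ Lp Le])
      show "(\<lambda>\<omega>. norm (d.S n \<omega>, e.S n \<omega>)) \<in> borel_measurable M" unfolding norm_Pair by measurable
      show "\<bar>norm (d.S n \<omega>, e.S n \<omega>)\<bar> \<le> \<bar>d.S n \<omega>\<bar> + \<bar>e.S n \<omega>\<bar>" for \<omega>
        using norm_Pair_le[of "d.S n \<omega>" "e.S n \<omega>"] by simp
    qed (use p in simp)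
    from Lp_spaceD(2)[OF this] show "integrable M (\<lambda>\<omega>. norm (d.S n \<omega>, e.S n \<omega>) powr p)" by simp
    show "\<bar>e.S n \<omega>\<bar> powr p \<le> norm (d.S n \<omega>, e.S n \<omega>) powr p" for \<omega>
      using p by (intro powr_mono2) (auto simp: norm_Pair real_le_rsqrt)
  qed
  ultimately show ?thesis using ab by fastforce
qed

end

section \<open>Exponents above 2\<close>

context dominated_differences
begin

lemma weighted_square_integrable:
  assumes "2 < p" "X \<in> Lp_space M p" "G \<in> Lp_space M p"
  shows "integrable M (\<lambda>\<omega>. \<bar>G \<omega>\<bar> powr (p - 2) * (X \<omega>)\<^sup>2)"
  by (rule integrable_Lp_mult[of "p - 2" 2 p, OF _ _ _ assms(3,2)])
    (use assms(1) Lp_spaceD(1)[OF assms(2)] Lp_spaceD(1)[OF assms(3)] in \<open>auto simp: abs_mult abs_powr_2\<close>)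

text \<open>A potential coupling the running maximum of the sums of \<open>e\<close> with the square
  of the sum of \<open>d\<close>; its increments dominate the mixed terms.\<close>

definition weighted_square :: "real \<Rightarrow> nat \<Rightarrow> real" where
  "weighted_square p k = (\<integral>\<omega>. \<bar>e.S_max k \<omega>\<bar> powr (p - 2) * (d.S k \<omega>)\<^sup>2 \<partial>M)"

text \<open>With the weight frozen at time \<open>k\<close>, the cross term
  \<open>2 * d.S k * d (Suc k)\<close> is orthogonal and only the square of the new difference
  remains. Updating the weight to the larger maximum only adds, because \<open>p > 2\<close>; this
  is why the maximum replaces \<open>|e.S k|\<close>.\<close>

lemma weighted_square_increment:
  assumes p: "2 < p" and Lp: "d.S (Suc k) \<in> Lp_space M p"
    and Lm: "e.S_max k \<in> Lp_space M p" "e.S_max (Suc k) \<in> Lp_space M p"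
  shows "(\<integral>\<omega>. \<bar>e.S_max k \<omega>\<bar> powr (p - 2) * (d (Suc k) \<omega>)\<^sup>2 \<partial>M)
       \<le> weighted_square p (Suc k) - weighted_square p k"
proof -
  let ?w = "\<lambda>\<omega>. \<bar>e.S_max k \<omega>\<bar> powr (p - 2)"
  let ?d = "d (Suc k)"
  have p1: "1 < p" using p by simp
  have Ld: "d.S k \<in> Lp_space M p" "?d \<in> Lp_space M p" using d.S_Lp_Suc d.x_Lp p1 Lp by auto
  note int = weighted_square_integrable[OF p _ Lm(1)]
  \<comment> \<open>Written this way, the cross term is a combination of three integrable functions,
    so its integrability needs no separate estimate.\<close>
  have cross_eq: "2 * ?w \<omega> * d.S k \<omega> * ?d \<omega>
      = ?w \<omega> * (d.S (Suc k) \<omega>)\<^sup>2 - ?w \<omega> * (d.S k \<omega>)\<^sup>2 - ?w \<omega> * (?d \<omega>)\<^sup>2" for \<omega>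
    by (simp add: d.S_Suc power2_eq_square algebra_simps)
  have cross: "integrable M (\<lambda>\<omega>. 2 * ?w \<omega> * d.S k \<omega> * ?d \<omega>)"
    unfolding cross_eq using int[OF Lp] int[OF Ld(1)] int[OF Ld(2)] by simp
  have "(\<integral>\<omega>. 2 * ?w \<omega> * d.S k \<omega> * ?d \<omega> \<partial>M) = 0"
    by (rule d.orthogonal[OF _ cross]) measurable
  then have "(\<integral>\<omega>. ?w \<omega> * (?d \<omega>)\<^sup>2 \<partial>M) = (\<integral>\<omega>. ?w \<omega> * (d.S (Suc k) \<omega>)\<^sup>2 \<partial>M) - weighted_square p k"
    unfolding cross_eq weighted_square_def using int[OF Lp] int[OF Ld(1)] int[OF Ld(2)] by simp
  also have "(\<integral>\<omega>. ?w \<omega> * (d.S (Suc k) \<omega>)\<^sup>2 \<partial>M) \<le> weighted_square p (Suc k)"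
    unfolding weighted_square_def
    by (rule integral_mono[OF int[OF Lp] weighted_square_integrable[OF p Lp Lm(2)]])
      (use p e.S_max_nonneg[of k] in \<open>auto intro!: mult_right_mono powr_mono2\<close>)
  finally show ?thesis by simp
qed

text \<open>The remainder of the second-order upper bound splits into a quadratic term with weight
  \<open>|e.S k| powr (p - 2)\<close> and a pure power. In both, \<open>e\<close> is replaced by
  \<open>d\<close>, with exponent 2 and exponent \<open>p\<close> respectively; then
  \<open>weighted_square\<close> absorbs the first and uniform convexity the second.\<close>

lemma powr_increment_le:
  assumes p: "2 < p" and Lp: "d.S (Suc k) \<in> Lp_space M p" and Le: "e.S k \<in> Lp_space M p"
    and Lm: "e.S_max k \<in> Lp_space M p" "e.S_max (Suc k) \<in> Lp_space M p"
  shows "(\<integral>\<omega>. \<bar>e.S (Suc k) \<omega>\<bar> powr p \<partial>M) - (\<integral>\<omega>. \<bar>e.S k \<omega>\<bar> powr p \<partial>M)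
       \<le> p * (p - 1) / 2 * 2 powr (p - 2) *
         ((weighted_square p (Suc k) - weighted_square p k)
          + 2 powr (p - 1) * ((\<integral>\<omega>. \<bar>d.S (Suc k) \<omega>\<bar> powr p \<partial>M) - (\<integral>\<omega>. \<bar>d.S k \<omega>\<bar> powr p \<partial>M)))"
proof -
  let ?d = "d (Suc k)" and ?e = "e (Suc k)"
  let ?c = "p * (p - 1) / 2 * 2 powr (p - 2)"
  let ?w = "\<lambda>\<omega>. \<bar>e.S k \<omega>\<bar> powr (p - 2)"
  have p1: "1 < p" using p by simp
  have Ld: "d.S k \<in> Lp_space M p" "?d \<in> Lp_space M p" using d.S_Lp_Suc d.x_Lp p1 Lp by auto
  have Lx: "?e \<in> Lp_space M p" by (rule e_Lp[OF p1 Ld(2)])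
  have Le': "e.S (Suc k) \<in> Lp_space M p"
    by (rule Lp_space_bound[OF _ Le Lx]) (use p in \<open>auto simp: e.S_Suc\<close>)
  note tan = e.tangent_orthogonal[OF p1 Le Lx]
  note wint = weighted_square_integrable[OF p _ Le]
  note ints = tan(1) wint[OF Lx] Lp_spaceD(2)[OF Le] Lp_spaceD(2)[OF Lx]
  have "(\<integral>\<omega>. \<bar>e.S (Suc k) \<omega>\<bar> powr p \<partial>M)
     \<le> (\<integral>\<omega>. \<bar>e.S k \<omega>\<bar> powr p + p * signed_powr (p - 1) (e.S k \<omega>) * ?e \<omega>
         + ?c * (?w \<omega> * (?e \<omega>)\<^sup>2 + \<bar>?e \<omega>\<bar> powr p) \<partial>M)"
  proof (rule integral_mono[OF Lp_spaceD(2)[OF Le']])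
    fix \<omega>
    have "(\<bar>e.S k \<omega>\<bar> + \<bar>?e \<omega>\<bar>) powr (p - 2) * (?e \<omega>)\<^sup>2
        \<le> 2 powr (p - 2) * (?w \<omega> + \<bar>?e \<omega>\<bar> powr (p - 2)) * (?e \<omega>)\<^sup>2"
      using p by (intro mult_right_mono add_powr_le) auto
    also have "\<dots> = 2 powr (p - 2) * (?w \<omega> * (?e \<omega>)\<^sup>2 + \<bar>?e \<omega>\<bar> powr p)"
      using powr_minus_2_mult[of "\<bar>?e \<omega>\<bar>" p] by (simp add: algebra_simps)
    finally have "p * (p - 1) / 2 * ((\<bar>e.S k \<omega>\<bar> + \<bar>?e \<omega>\<bar>) powr (p - 2) * (?e \<omega>)\<^sup>2)
       \<le> p * (p - 1) / 2 * (2 powr (p - 2) * (?w \<omega> * (?e \<omega>)\<^sup>2 + \<bar>?e \<omega>\<bar> powr p))"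
      using p by (intro mult_left_mono) auto
    then show "\<bar>e.S (Suc k) \<omega>\<bar> powr p \<le> \<bar>e.S k \<omega>\<bar> powr p + p * signed_powr (p - 1) (e.S k \<omega>) * ?e \<omega>
         + ?c * (?w \<omega> * (?e \<omega>)\<^sup>2 + \<bar>?e \<omega>\<bar> powr p)"
      using abs_powr_second_order(2)[OF p1 less_imp_le[OF p], of "e.S k \<omega>" "?e \<omega>"]
      unfolding e.S_Suc mult.assoc by linarith
  qed (use ints in auto)
  also have "\<dots> = (\<integral>\<omega>. \<bar>e.S k \<omega>\<bar> powr p \<partial>M) + ?c * ((\<integral>\<omega>. ?w \<omega> * (?e \<omega>)\<^sup>2 \<partial>M) + (\<integral>\<omega>. \<bar>?e \<omega>\<bar> powr p \<partial>M))"
    using ints tan(2) by simp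
  finally have main: "(\<integral>\<omega>. \<bar>e.S (Suc k) \<omega>\<bar> powr p \<partial>M) - (\<integral>\<omega>. \<bar>e.S k \<omega>\<bar> powr p \<partial>M)
     \<le> ?c * ((\<integral>\<omega>. ?w \<omega> * (?e \<omega>)\<^sup>2 \<partial>M) + (\<integral>\<omega>. \<bar>?e \<omega>\<bar> powr p \<partial>M))" by simp
  have "(\<integral>\<omega>. ?w \<omega> * (?e \<omega>)\<^sup>2 \<partial>M) \<le> (\<integral>\<omega>. ?w \<omega> * (?d \<omega>)\<^sup>2 \<partial>M)"
    using weighted_powr_le(2)[of 2 ?w k] wint[OF Ld(2)] by (simp add: abs_powr_2)
  also have "\<dots> \<le> (\<integral>\<omega>. \<bar>e.S_max k \<omega>\<bar> powr (p - 2) * (?d \<omega>)\<^sup>2 \<partial>M)"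
    by (rule integral_mono[OF wint[OF Ld(2)] weighted_square_integrable[OF p Ld(2) Lm(1)]])
      (use p in \<open>auto intro!: mult_right_mono powr_mono2 order_trans[OF e.abs_S_le_S_max]\<close>)
  also have "\<dots> \<le> weighted_square p (Suc k) - weighted_square p k"
    by (rule weighted_square_increment[OF p Lp Lm])
  finally have 1: "(\<integral>\<omega>. ?w \<omega> * (?e \<omega>)\<^sup>2 \<partial>M) \<le> weighted_square p (Suc k) - weighted_square p k" .
  have "(\<integral>\<omega>. \<bar>?e \<omega>\<bar> powr p \<partial>M) \<le> (\<integral>\<omega>. \<bar>?d \<omega>\<bar> powr p \<partial>M)"
    by (rule e_Lp(2)[OF p1 Ld(2)])
  \<comment> \<open>The factor \<open>2 powr (p - 1)\<close> cancels the
    \<open>2 powr (1 - p)\<close> of the uniform convexity bound.\<close>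
  also have "\<dots> = 2 powr (p - 1) * (2 powr (1 - p) * (\<integral>\<omega>. \<bar>?d \<omega>\<bar> powr p \<partial>M))"
    by (simp flip: mult.assoc powr_add)
  also have "\<dots> \<le> 2 powr (p - 1) * ((\<integral>\<omega>. \<bar>d.S (Suc k) \<omega>\<bar> powr p \<partial>M) - (\<integral>\<omega>. \<bar>d.S k \<omega>\<bar> powr p \<partial>M))"
    using p by (intro mult_left_mono d.powr_increment Lp) auto
  finally have "(\<integral>\<omega>. ?w \<omega> * (?e \<omega>)\<^sup>2 \<partial>M) + (\<integral>\<omega>. \<bar>?e \<omega>\<bar> powr p \<partial>M)
     \<le> (weighted_square p (Suc k) - weighted_square p k)
          + 2 powr (p - 1) * ((\<integral>\<omega>. \<bar>d.S (Suc k) \<omega>\<bar> powr p \<partial>M) - (\<integral>\<omega>. \<bar>d.S k \<omega>\<bar> powr p \<partial>M))"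
    using 1 by (rule add_mono[rotated])
  then have "?c * ((\<integral>\<omega>. ?w \<omega> * (?e \<omega>)\<^sup>2 \<partial>M) + (\<integral>\<omega>. \<bar>?e \<omega>\<bar> powr p \<partial>M))
     \<le> ?c * ((weighted_square p (Suc k) - weighted_square p k)
          + 2 powr (p - 1) * ((\<integral>\<omega>. \<bar>d.S (Suc k) \<omega>\<bar> powr p \<partial>M) - (\<integral>\<omega>. \<bar>d.S k \<omega>\<bar> powr p \<partial>M)))"
    using p by (intro mult_left_mono) auto
  with main show ?thesis by (rule order_trans)
qed

end

text \<open>\<open>c\<close> comes from the second-order remainder and \<open>D\<close> from the
  maximal inequality; \<open>\<epsilon>\<close> is chosen with
  \<open>c * \<epsilon> * D = 1 / 2\<close>, so that half of the left-hand side can be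
  absorbed.\<close>

definition const_gt_2 :: "real \<Rightarrow> real" where
  "const_gt_2 p =
    (let c = p * (p - 1) / 2 * 2 powr (p - 2);
         D = ((1 - 1 / p) / 2) powr (- p);
         \<epsilon> = 1 / (2 * c * D)
     in 2 * c * (\<epsilon> powr (- ((p - 2) / 2)) + 2 powr (p - 1)))"

text \<open>Telescoping bounds the moment of \<open>e.S n\<close> by
  \<open>weighted_square p n\<close> and the moment of \<open>d.S n\<close>. Young's inequality and
  the maximal inequality then bound the weighted square by a small multiple of the left-hand side
  plus a multiple of the moment of \<open>d.S n\<close>.\<close>

lemma (in dominated_differences) moment_gt_2:
  assumes p: "2 < p" and Lp: "d.S n \<in> Lp_space M p"
  shows "(\<integral>\<omega>. \<bar>e.S n \<omega>\<bar> powr p \<partial>M) \<le> const_gt_2 p * (\<integral>\<omega>. \<bar>d.S n \<omega>\<bar> powr p \<partial>M)"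
proof -
  define c where "c = p * (p - 1) / 2 * 2 powr (p - 2)"
  define D where "D = ((1 - 1 / p) / 2) powr (- p)"
  define \<epsilon> where "\<epsilon> = 1 / (2 * c * D)"
  define C where "C = \<epsilon> powr (- ((p - 2) / 2))"
  have p1: "1 < p" using p by simp
  have pos: "0 < c" "0 < D" "0 < \<epsilon>" using p by (auto simp: c_def D_def \<epsilon>_def)
  have const: "const_gt_2 p = 2 * c * (C + 2 powr (p - 1))"
    by (simp add: const_gt_2_def Let_def C_def \<epsilon>_def c_def D_def)
  define N where "N k = (\<integral>\<omega>. \<bar>e.S k \<omega>\<bar> powr p \<partial>M)" for k
  define B where "B k = (\<integral>\<omega>. \<bar>d.S k \<omega>\<bar> powr p \<partial>M)" for k
  have Ld: "d.S k \<in> Lp_space M p" if "k \<le> n" for k by (rule d.S_Lp[OF p1 Lp that])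
  have Le: "e.S k \<in> Lp_space M p" if "k \<le> n" for k by (rule e_S_Lp[OF p1 Lp that])
  have Lm: "e.S_max k \<in> Lp_space M p" if "k \<le> n" for k by (rule e.S_max_Lp[OF p1 Le that])
  have "N k \<le> c * (weighted_square p k + 2 powr (p - 1) * B k)" if "k \<le> n" for k
    using that
  proof (induction k)
    case (Suc k)
    have "N (Suc k) - N k \<le> c * ((weighted_square p (Suc k) - weighted_square p k) + 2 powr (p - 1) * (B (Suc k) - B k))"
      unfolding N_def B_def c_def using Suc.prems by (intro powr_increment_le p Ld Le Lm) auto
    with Suc show ?case by (simp add: algebra_simps)
  qed (simp add: N_def B_def weighted_square_def)
  then have "N n \<le> c * (weighted_square p n + 2 powr (p - 1) * B n)" by simp
  also have "weighted_square p n \<le> \<epsilon> * (D * N n) + C * B n"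
  proof -
    have max: "integrable M (\<lambda>\<omega>. e.S_max n \<omega> powr p)"
      using Lp_spaceD(2)[OF Lm[OF order_refl]] by (simp add: abs_of_nonneg e.S_max_nonneg)
    have "weighted_square p n \<le> (\<integral>\<omega>. \<epsilon> * e.S_max n \<omega> powr p + C * \<bar>d.S n \<omega>\<bar> powr p \<partial>M)"
      unfolding weighted_square_def
    proof (rule integral_mono[OF weighted_square_integrable[OF p Lp Lm[OF order_refl]]])
      show "integrable M (\<lambda>\<omega>. \<epsilon> * e.S_max n \<omega> powr p + C * \<bar>d.S n \<omega>\<bar> powr p)"
        using max Lp_spaceD(2)[OF Lp] by simp
      show "\<bar>e.S_max n \<omega>\<bar> powr (p - 2) * (d.S n \<omega>)\<^sup>2 \<le> \<epsilon> * e.S_max n \<omega> powr p + C * \<bar>d.S n \<omega>\<bar> powr p" for \<omega>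
        using powr_mult_powr_le[of "p - 2" 2 \<epsilon> "e.S_max n \<omega>" "\<bar>d.S n \<omega>\<bar>"] p pos e.S_max_nonneg[of n \<omega>]
        by (simp add: abs_powr_2 C_def)
    qed
    also have "\<dots> = \<epsilon> * (\<integral>\<omega>. e.S_max n \<omega> powr p \<partial>M) + C * B n"
      using max Lp_spaceD(2)[OF Lp] by (simp add: B_def)
    also have "(\<integral>\<omega>. e.S_max n \<omega> powr p \<partial>M) \<le> D * N n"
      unfolding D_def N_def by (rule e.doob_maximal[OF p1 Le])
    finally show ?thesis using pos by simp
  qed
  \<comment> \<open>By the choice of \<open>\<epsilon>\<close> the coefficient of \<open>N n\<close>
    is exactly one half; the final step moves it to the left and doubles.\<close>
  also have "c * (\<epsilon> * (D * N n) + C * B n + 2 powr (p - 1) * B n) = N n / 2 + c * (C + 2 powr (p - 1)) * B n"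
    using pos by (simp add: \<epsilon>_def field_simps)
  finally show ?thesis using pos by (simp add: const N_def B_def)
qed

section \<open>Combination of the two ranges of exponents and passage to norms\<close>

definition moment_const :: "real \<Rightarrow> real" where
  "moment_const p = 1 + \<bar>if p \<le> 2 then const_le_2 p else const_gt_2 p\<bar>"

lemma (in dominated_differences) moment_le:
  assumes p: "1 < p" and Lp: "d.S n \<in> Lp_space M p"
  shows "(\<integral>\<omega>. \<bar>e.S n \<omega>\<bar> powr p \<partial>M) \<le> moment_const p * (\<integral>\<omega>. \<bar>d.S n \<omega>\<bar> powr p \<partial>M)"
proof -
  let ?C = "if p \<le> 2 then const_le_2 p else const_gt_2 p"
  have "(\<integral>\<omega>. \<bar>e.S n \<omega>\<bar> powr p \<partial>M) \<le> ?C * (\<integral>\<omega>. \<bar>d.S n \<omega>\<bar> powr p \<partial>M)"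
    using moment_le_2[OF p _ Lp] moment_gt_2[OF _ Lp] by auto
  also have "\<dots> \<le> moment_const p * (\<integral>\<omega>. \<bar>d.S n \<omega>\<bar> powr p \<partial>M)"
    unfolding moment_const_def by (rule mult_right_mono) auto
  finally show ?thesis .
qed

lemma moment_comparison_exists:
  assumes p: "1 < p"
  shows "\<exists>c>0. moment_comparison TYPE('a) p c"
proof -
  let ?C = "moment_const p"
  have C: "0 < ?C" by (simp add: moment_const_def)
  let ?c = "?C powr (1 / p)"
  have "moment_comparison TYPE('a) p ?c"
    unfolding moment_comparison_def
  proof (intro allI impI)
    fix M :: "'a measure" and F d e n
    assume H: "prob_space M" "filtration (space M) F" "\<forall>k. subalgebra M (F k)"
      "martingale_difference M F d" "martingale_difference M F e" "max_dominated M F e d"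
    interpret prob_space M by fact
    interpret dominated_differences M F d e
      by (intro dominated_differences.intro dominated_differences_axioms.intro martingale_differences.intro
          martingale_differences_axioms.intro H H(3)[rule_format])
    have "Lp_norm M p (e.S n) \<le> ennreal ?c * Lp_norm M p (d.S n)"
    proof (cases "(\<integral>\<^sup>+\<omega>. ennreal (\<bar>d.S n \<omega>\<bar> powr p) \<partial>M) = \<infinity>")
      case True
      \<comment> \<open>The right-hand side is infinite because the constant is positive; in
        \<open>ennreal\<close> a zero constant would give 0 here.\<close>
      then show ?thesis using C by (simp add: Lp_norm_def Let_def ennreal_mult_top)
    next
      case False
      then have int: "integrable M (\<lambda>\<omega>. \<bar>d.S n \<omega>\<bar> powr p)"
        by (intro integrableI_nonneg) (auto simp: less_top)
      then have L: "d.S n \<in> Lp_space M p" by (simp add: Lp_space_def)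
      note le = moment_le[OF p L] Lp_spaceD(2)[OF e_S_Lp[OF p L order_refl]]
      have eq: "Lp_norm M p X = ennreal ((\<integral>\<omega>. \<bar>X \<omega>\<bar> powr p \<partial>M) powr (1 / p))"
        if "integrable M (\<lambda>\<omega>. \<bar>X \<omega>\<bar> powr p)" for X
        using that by (simp add: Lp_norm_def nn_integral_eq_integral)
      have "(\<integral>\<omega>. \<bar>e.S n \<omega>\<bar> powr p \<partial>M) powr (1 / p) \<le> (?C * (\<integral>\<omega>. \<bar>d.S n \<omega>\<bar> powr p \<partial>M)) powr (1 / p)"
        using le p by (intro powr_mono2) auto
      also have "\<dots> = ?c * (\<integral>\<omega>. \<bar>d.S n \<omega>\<bar> powr p \<partial>M) powr (1 / p)"
        using C by (simp add: powr_mult)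
      finally show ?thesis using le int by (simp add: eq ennreal_leI flip: ennreal_mult)
    qed
    then show "Lp_norm M p (\<lambda>\<omega>. \<Sum>k=1..n. e k \<omega>) \<le> ennreal ?c * Lp_norm M p (\<lambda>\<omega>. \<Sum>k=1..n. d k \<omega>)"
      by (simp add: d.S_def[abs_def] e.S_def[abs_def])
  qed
  then show ?thesis using C by (intro exI[of _ ?c]) simp
qed

subsection \<open>Passage to the path space\<close>

text \<open>The natural filtration of the coordinates from index 1 on. Stage 0 has no generators and
  is therefore trivial, as the hypothesis on \<open>F 0\<close> demands.\<close>

definition path_filtration :: "nat \<Rightarrow> (nat \<Rightarrow> real \<times> real) measure" where
  "path_filtration k = sigma UNIV {(\<lambda>y. y j) -` B | j B. 1 \<le> j \<and> j \<le> k \<and> B \<in> sets borel}"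

text \<open>The entries \<open>d 0\<close> and \<open>e 0\<close> are arbitrary functions, possibly
  not measurable, so coordinate 0 is set to a constant.\<close>

definition sample_path :: "(nat \<Rightarrow> 'a \<Rightarrow> real) \<Rightarrow> (nat \<Rightarrow> 'a \<Rightarrow> real) \<Rightarrow> 'a \<Rightarrow> nat \<Rightarrow> real \<times> real" where
  "sample_path d e \<omega> k = (if k = 0 then (0, 0) else (d k \<omega>, e k \<omega>))"

lemma space_path_filtration [simp]: "space (path_filtration k) = UNIV"
  by (simp add: path_filtration_def space_measure_of_conv)

lemma sets_path_filtration:
  "sets (path_filtration k) = sigma_sets UNIV {(\<lambda>y. y j) -` B | j B. 1 \<le> j \<and> j \<le> k \<and> B \<in> sets borel}"
  by (simp add: path_filtration_def sets_measure_of_conv)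

lemma sets_path_filtration_0: "sets (path_filtration 0) = {{}, UNIV}"
  by (simp add: sets_path_filtration sigma_sets_empty_eq)

lemma filtration_path_filtration: "filtration UNIV path_filtration"
proof
  fix i j :: nat assume "i \<le> j"
  then have "{(\<lambda>y. y l) -` B | l B. 1 \<le> l \<and> l \<le> i \<and> B \<in> sets borel}
      \<subseteq> {(\<lambda>y. y l) -` B | l B. 1 \<le> l \<and> l \<le> j \<and> B \<in> sets (borel :: (real \<times> real) measure)}"
    using order_trans by blast
  then show "sets (path_filtration i) \<subseteq> sets (path_filtration j)"
    unfolding sets_path_filtration by (rule sigma_sets_mono')
qed simp

lemma coordinate_path_filtration:
  assumes "1 \<le> j" "j \<le> k"
  shows "(\<lambda>y. y j) \<in> measurable (path_filtration k) borel"
  by (rule measurableI) (use assms in \<open>auto simp: sets_path_filtration intro!: sigma_sets.Basic\<close>)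

lemma sets_path_filtration_le:
  "sets (path_filtration k) \<subseteq> sets (PiM UNIV (\<lambda>_. borel :: (real \<times> real) measure))"
proof -
  let ?P = "PiM UNIV (\<lambda>_::nat. borel :: (real \<times> real) measure)"
  have "(\<lambda>y. y j) -` B \<in> sets ?P" if "B \<in> sets borel" for j :: nat and B :: "(real \<times> real) set"
    using measurable_sets[OF measurable_component_singleton[of j UNIV "\<lambda>_. borel"] that]
    by (simp add: space_PiM)
  then show ?thesis
    using sets.sigma_sets_subset[of "{(\<lambda>y. y j) -` B | j B. 1 \<le> j \<and> j \<le> k \<and> B \<in> sets borel}" ?P]
    unfolding sets_path_filtration by (auto simp: space_PiM)
qed

section \<open>The joint law of the two sequences and the hypotheses it inherits\<close>

locale path_law = prob_space M for M :: "'a measure" +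
  fixes F d e
  assumes filtration: "filtration (space M) F"
    and subalgebra: "\<And>k. subalgebra M (F k)"
    and d: "martingale_difference M F d"
    and e: "martingale_difference M F e"
begin

abbreviation P :: "(nat \<Rightarrow> real \<times> real) measure" where
  "P \<equiv> PiM UNIV (\<lambda>_. borel)"

definition law :: "(nat \<Rightarrow> real \<times> real) measure" where
  "law = distr M P (sample_path d e)"

sublocale d: martingale_differences M F d
  by (intro martingale_differences.intro martingale_differences_axioms.intro prob_space_axioms filtration subalgebra d)

sublocale e: martingale_differences M F e
  by (intro martingale_differences.intro martingale_differences_axioms.intro prob_space_axioms filtration subalgebra e)

lemma path_measurable_F: "sample_path d e \<in> measurable (F k) (path_filtration k)"
  unfolding path_filtration_def
proof (rule measurable_measure_of)
  fix A assume "A \<in> {(\<lambda>y. y j) -` B | j B. 1 \<le> j \<and> j \<le> k \<and> B \<in> sets (borel :: (real \<times> real) measure)}"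
  then obtain j B where j: "1 \<le> j" "j \<le> k" and B: "B \<in> sets (borel :: (real \<times> real) measure)" and A: "A = (\<lambda>y. y j) -` B"
    by blast
  obtain i where i: "j = Suc i" using j by (cases j) auto
  have "d j \<in> borel_measurable (F k)" "e j \<in> borel_measurable (F k)"
    using d.measurable_F_mono[OF d.x_F] e.measurable_F_mono[OF e.x_F] j by (auto simp: i)
  then have "(\<lambda>\<omega>. (d j \<omega>, e j \<omega>)) \<in> borel_measurable (F k)" by (rule borel_measurable_Pair)
  from measurable_sets[OF this B] show "sample_path d e -` A \<inter> space (F k) \<in> sets (F k)"
    using j by (simp add: A sample_path_def vimage_def)
qed auto

lemma path_measurable [measurable]: "sample_path d e \<in> measurable M P"
  unfolding sample_path_def[abs_def]
proof (rule measurable_PiM_single')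
  show "(\<lambda>\<omega>. if k = 0 then (0, 0) else (d k \<omega>, e k \<omega>)) \<in> borel_measurable M" for k
    by (cases k) (auto intro!: borel_measurable_Pair d.x_M e.x_M)
qed (auto simp: space_PiM)

lemma prob_space_law: "prob_space law"
  unfolding law_def by (rule prob_space_distr[OF path_measurable])

lemma space_law [simp]: "space law = UNIV"
  by (simp add: law_def space_PiM)

lemma sets_law [simp]: "sets law = sets P"
  by (simp add: law_def)

lemma subalgebra_law: "subalgebra law (path_filtration k)"
  using sets_path_filtration_le by (simp add: subalgebra_def)

lemma measurable_law:
  assumes "f \<in> measurable (path_filtration k) N"
  shows "f \<in> measurable P N"
  using measurable_from_subalg[OF subalgebra_law assms] by (simp cong: measurable_cong_sets)

text \<open>Used with \<open>\<pi>\<close> as either projection. The conditional expectation is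
  identified by its integrals over sets \<open>A\<close> of the path filtration: the preimage of
  \<open>A\<close> under the sample path belongs to \<open>F i\<close>, so these integrals vanish by
  orthogonality on the original space.\<close>

lemma martingale_difference_law:
  fixes \<pi> :: "real \<times> real \<Rightarrow> real"
  assumes \<pi>: "\<pi> \<in> borel_measurable borel"
    and x: "martingale_differences M F x" and eq: "\<And>k \<omega>. \<pi> (sample_path d e \<omega> (Suc k)) = x (Suc k) \<omega>"
  shows "martingale_difference law path_filtration (\<lambda>k y. \<pi> (y k))"
  unfolding martingale_difference_def
proof (intro allI impI)
  interpret x: martingale_differences M F x by (rule x)
  fix k :: nat assume "1 \<le> k"
  then obtain i where k: "k = Suc i" by (cases k) auto
  have meas: "(\<lambda>y. \<pi> (y k)) \<in> borel_measurable (path_filtration k)"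
    by (rule measurable_compose[OF coordinate_path_filtration \<pi>]) (use k in auto)
  note [measurable] = measurable_law[OF meas, unfolded k]
  have int: "integrable law (\<lambda>y. \<pi> (y k))"
    unfolding law_def by (subst integrable_distr_eq) (auto simp: k eq x.x_integrable)
  interpret L: prob_space law by (rule prob_space_law)
  interpret sub: sigma_finite_subalgebra law "path_filtration i"
    by (intro finite_measure_subalgebra_is_sigma_finite finite_measure_subalgebra.intro
      finite_measure_subalgebra_axioms.intro subalgebra_law L.finite_measure_axioms)
  have "AE y in law. real_cond_exp law (path_filtration i) (\<lambda>y. \<pi> (y k)) y = 0"
  proof (rule sub.real_cond_exp_charact[OF _ int])
    fix A assume A: "A \<in> sets (path_filtration i)"
    then have [measurable]: "A \<in> sets P" using sets_path_filtration_le by blast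
    have g: "(\<lambda>\<omega>. indicator A (sample_path d e \<omega>) :: real) \<in> borel_measurable (F i)"
      by (rule measurable_compose[OF path_measurable_F]) (use A in simp)
    have "(\<integral>y\<in>A. \<pi> (y k) \<partial>law) = (\<integral>\<omega>. indicator A (sample_path d e \<omega>) * x (Suc i) \<omega> \<partial>M)"
      unfolding law_def set_lebesgue_integral_def by (subst integral_distr) (auto simp: k eq)
    also have "\<dots> = 0"
    proof (rule x.orthogonal[OF g])
      show "integrable M (\<lambda>\<omega>. indicator A (sample_path d e \<omega>) * x (Suc i) \<omega>)"
        by (rule Bochner_Integration.integrable_bound[OF x.x_integrable[of i]]) (auto simp: indicator_def)
    qed
    finally show "(\<integral>y\<in>A. \<pi> (y k) \<partial>law) = (\<integral>y\<in>A. 0 \<partial>law)" by simp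
  qed auto
  with int meas show "integrable law (\<lambda>y. \<pi> (y k)) \<and> (\<lambda>y. \<pi> (y k)) \<in> borel_measurable (path_filtration k) \<and>
    (AE y in law. real_cond_exp law (path_filtration (k - 1)) (\<lambda>y. \<pi> (y k)) y = 0)"
    by (simp add: k)
qed

lemma projections_measurable:
  "fst \<in> borel_measurable (borel :: (real \<times> real) measure)"
  "snd \<in> borel_measurable (borel :: (real \<times> real) measure)"
  by (auto intro!: borel_measurable_continuous_onI continuous_intros)

lemma coordinates_measurable [measurable]:
  "(\<lambda>y. fst (y k)) \<in> borel_measurable P" "(\<lambda>y. snd (y k)) \<in> borel_measurable P"
  by (rule measurable_compose[OF measurable_component_singleton[OF UNIV_I]], rule projections_measurable)+

text \<open>A predictable sequence on path space, composed with the sample path, is predictable for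
  \<open>F\<close>; the hypothesis for the composite is the claim after a change of
  variables.\<close>

lemma max_dominated_law:
  assumes "max_dominated M F e d"
  shows "max_dominated law path_filtration (\<lambda>k y. snd (y k)) (\<lambda>k y. fst (y k))"
  unfolding max_dominated_def
proof (intro allI impI)
  fix s k
  assume s: "predictable path_filtration s" "bounded_nonneg law s" and k: "(1::nat) \<le> k"
  have sk: "s k \<in> borel_measurable (path_filtration (k - 1))"
    using s(1) k by (simp add: predictable_def)
  note [measurable] = measurable_law[OF sk]
  define s' where "s' k \<omega> = s k (sample_path d e \<omega>)" for k \<omega>
  have "predictable F s'"
    using s(1) unfolding predictable_def s'_def[abs_def]
    by (auto intro: measurable_compose[OF path_measurable_F])
  moreover have "bounded_nonneg M s'"
    using s(2) unfolding bounded_nonneg_def s'_def by auto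
  ultimately have "(\<integral>\<omega>. max (s' k \<omega>) \<bar>e k \<omega>\<bar> \<partial>M) \<le> (\<integral>\<omega>. max (s' k \<omega>) \<bar>d k \<omega>\<bar> \<partial>M)"
    using assms k by (simp add: max_dominated_def)
  then show "(\<integral>y. max (s k y) \<bar>snd (y k)\<bar> \<partial>law) \<le> (\<integral>y. max (s k y) \<bar>fst (y k)\<bar> \<partial>law)"
    unfolding law_def using k by (simp add: integral_distr s'_def sample_path_def)
qed

lemma Lp_norm_law:
  "Lp_norm law p (\<lambda>y. \<Sum>k=1..n. fst (y k)) = Lp_norm M p (\<lambda>\<omega>. \<Sum>k=1..n. d k \<omega>)"
  "Lp_norm law p (\<lambda>y. \<Sum>k=1..n. snd (y k)) = Lp_norm M p (\<lambda>\<omega>. \<Sum>k=1..n. e k \<omega>)"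
proof -
  have "(\<Sum>k=1..n. fst (sample_path d e \<omega> k)) = (\<Sum>k=1..n. d k \<omega>)"
    "(\<Sum>k=1..n. snd (sample_path d e \<omega> k)) = (\<Sum>k=1..n. e k \<omega>)" for \<omega>
    by (auto simp: sample_path_def intro!: sum.cong)
  then show "Lp_norm law p (\<lambda>y. \<Sum>k=1..n. fst (y k)) = Lp_norm M p (\<lambda>\<omega>. \<Sum>k=1..n. d k \<omega>)"
    "Lp_norm law p (\<lambda>y. \<Sum>k=1..n. snd (y k)) = Lp_norm M p (\<lambda>\<omega>. \<Sum>k=1..n. e k \<omega>)"
    unfolding Lp_norm_def law_def by (simp_all add: nn_integral_distr)
qed

end

text \<open>Any instance over any type of sample points has the same norms as its joint law on path
  space, so one constant for the path type serves every type.\<close>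

lemma moment_comparison_transfer:
  assumes "moment_comparison TYPE(nat \<Rightarrow> real \<times> real) p c"
  shows "moment_comparison TYPE('a) p c"
  unfolding moment_comparison_def
proof (intro allI impI)
  fix M :: "'a measure" and F d e n
  assume H: "prob_space M" "filtration (space M) F" "\<forall>k. subalgebra M (F k)"
    "martingale_difference M F d" "martingale_difference M F e" "max_dominated M F e d" and n: "(1::nat) \<le> n"
  interpret path_law M F d e
    by (intro path_law.intro path_law_axioms.intro H H(3)[rule_format])
  have "Lp_norm law p (\<lambda>y. \<Sum>k=1..n. snd (y k)) \<le> ennreal c * Lp_norm law p (\<lambda>y. \<Sum>k=1..n. fst (y k))"
  proof (rule assms[unfolded moment_comparison_def, rule_format, of law path_filtration "\<lambda>k y. fst (y k)" "\<lambda>k y. snd (y k)" n])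
    show "martingale_difference law path_filtration (\<lambda>k y. fst (y k))"
      by (rule martingale_difference_law[OF projections_measurable(1) d.martingale_differences_axioms]) (simp add: sample_path_def)
    show "martingale_difference law path_filtration (\<lambda>k y. snd (y k))"
      by (rule martingale_difference_law[OF projections_measurable(2) e.martingale_differences_axioms]) (simp add: sample_path_def)
  qed (use n prob_space_law filtration_path_filtration subalgebra_law sets_path_filtration_0 max_dominated_law[OF H(6)] in auto)
  then show "Lp_norm M p (\<lambda>\<omega>. \<Sum>k=1..n. e k \<omega>) \<le> ennreal c * Lp_norm M p (\<lambda>\<omega>. \<Sum>k=1..n. d k \<omega>)"
    by (simp only: Lp_norm_law)
qed

theorem theorem1:
  fixes p :: real
  assumes "1 < p"
  shows "0 < comparison_const p \<and> moment_comparison TYPE('a) p (comparison_const p)"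
proof -
  \<comment> \<open>The choice in \<open>comparison_const\<close> is over a nonempty set, by the
    existence result at the path type.\<close>
  have "0 < comparison_const p \<and> moment_comparison TYPE(nat \<Rightarrow> real \<times> real) p (comparison_const p)"
    unfolding comparison_const_def by (rule someI_ex) (use moment_comparison_exists[OF assms] in blast)
  then show ?thesis by (blast intro: moment_comparison_transfer)
qed

end
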